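(* Let $0\le\alpha<1$, let $p\ge q\ge2$ and $n$ be integers with $p+q\le n-1$ and $n\not\equiv p+q\pmod 2$, and let $G\in\mathcal{G}_{n,p,q}$. Then $\lambda_\alpha(G)\ge\lambda_\alpha(B^1_{n,p,q})$, with equality if and only if $G\cong B^1_{n,p,q}$.
   Context: All digraphs are simple. For a digraph $G$, $A(G)$ is its adjacency matrix and $D(G)$ the diagonal matrix of outdegrees; $A_\alpha(G)=\alpha D(G)+(1-\alpha)A(G)$ and $\lambda_\alpha(G)$ is the largest modulus of an eigenvalue of $A_\alpha(G)$. A digraph is bipartite if its vertex set splits into two disjoint sets with every arc going between them. $\overleftrightarrow{K_{p,q}}$ is the complete bipartite digraph obtained from $K_{p,q}$ by replacing each edge with a pair of opposite arcs; $\mathcal{G}_{n,p,q}$ is the set of strongly connected bipartite digraphs on $n$ vertices containing $\overleftrightarrow{K_{p,q}}$ as a subdigraph. Let $\overleftrightarrow{K_{p,q}}$ have parts $V_p=\{v_1,\ldots,v_p\}$ and $V_q=\{v_{p+1},\ldots,v_{p+q}\}$, and let $v_{p+q+1},\ldots,v_n$ be new vertices. $B^1_{n,p,q}$ is obtained from $\overleftrightarrow{K_{p,q}}$ by adding the directed path $v_1v_{p+q+1}v_{p+q+2}\cdots v_nv_p$. *)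

theory Defs
  imports
    "Graph_Theory.Graph_Theory"
    "Jordan_Normal_Form.Spectral_Radius"
    "HOL-Number_Theory.Cong"
begin

text \<open>
  Simple digraphs are those of the locale \<^locale>\<open>digraph\<close> (finite, no loops, no parallel arcs;
  opposite arcs are allowed). Matrices are taken with respect to an enumeration \<open>vs\<close> of
  the vertices.
\<close>

definition adjacency_mat :: "'a list \<Rightarrow> ('a,'b) pre_digraph \<Rightarrow> real mat" where
  "adjacency_mat vs G = mat (length vs) (length vs)
     (\<lambda>(i,j). if vs ! i \<rightarrow>\<^bsub>G\<^esub> vs ! j then 1 else 0)"

definition outdegree_mat :: "'a list \<Rightarrow> ('a,'b) pre_digraph \<Rightarrow> real mat" where
  "outdegree_mat vs G = mat (length vs) (length vs)
     (\<lambda>(i,j). if i = j then real (out_degree G (vs ! i)) else 0)"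

definition A_alpha :: "real \<Rightarrow> 'a list \<Rightarrow> ('a,'b) pre_digraph \<Rightarrow> real mat" where
  "A_alpha \<alpha> vs G = \<alpha> \<cdot>\<^sub>m outdegree_mat vs G + (1 - \<alpha>) \<cdot>\<^sub>m adjacency_mat vs G"

text \<open>
  The choice of the enumeration is immaterial, see \<open>lambda_alpha_eq\<close> below.
\<close>

definition lambda_alpha :: "real \<Rightarrow> ('a,'b) pre_digraph \<Rightarrow> real" where
  "lambda_alpha \<alpha> G = spectral_radius (map_mat complex_of_real
     (A_alpha \<alpha> (SOME vs. distinct vs \<and> set vs = verts G) G))"

definition bipartite_digraph :: "('a,'b) pre_digraph \<Rightarrow> bool" where
  "bipartite_digraph G \<longleftrightarrow> (\<exists>X Y. verts G = X \<union> Y \<and> X \<inter> Y = {} \<and>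
     (\<forall>u v. u \<rightarrow>\<^bsub>G\<^esub> v \<longrightarrow> u \<in> X \<and> v \<in> Y \<or> u \<in> Y \<and> v \<in> X))"

definition bip_class :: "nat \<Rightarrow> nat \<Rightarrow> nat \<Rightarrow> ('a,'b) pre_digraph set" where
  "bip_class n p q = {G. digraph G \<and> card (verts G) = n \<and> strongly_connected G \<and>
     bipartite_digraph G \<and> (\<exists>H. subgraph H G \<and> K\<^bsub>p,q\<^esub> H)}"

text \<open>The vertex \<open>v\<^sub>i\<close> is represented by the number \<open>i\<close>.\<close>

definition K_bip :: "nat \<Rightarrow> nat \<Rightarrow> nat pair_pre_digraph" where
  "K_bip p q = \<lparr> pverts = {1..p} \<union> {p+1..p+q},
     parcs = {1..p} \<times> {p+1..p+q} \<union> {p+1..p+q} \<times> {1..p} \<rparr>"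

definition B1 :: "nat \<Rightarrow> nat \<Rightarrow> nat \<Rightarrow> nat pair_pre_digraph" where
  "B1 n p q = \<lparr> pverts = pverts (K_bip p q) \<union> {p+q+1..n},
     parcs = parcs (K_bip p q) \<union> set (vwalk_arcs (1 # [p+q+1..<n+1] @ [p])) \<rparr>"

lemma K_bip_complete_bipartite: "K\<^bsub>p,q\<^esub> (with_proj (K_bip p q))"
  unfolding complete_bipartite_digraph_pair_def K_bip_def
  by (intro conjI exI[of _ "{1..p}"] exI[of _ "{p+1..p+q}"]) auto

lemma eigenvalue_A_alpha_iff:
  assumes vs: "distinct vs" "set vs = verts G"
  shows "eigenvalue (map_mat complex_of_real (A_alpha \<alpha> vs G)) k \<longleftrightarrow>
    (\<exists>x. (\<exists>v\<in>verts G. x v \<noteq> 0) \<and>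
      (\<forall>v\<in>verts G. (\<Sum>w\<in>verts G. complex_of_real
          (\<alpha> * (if v = w then real (out_degree G v) else 0)
           + (1 - \<alpha>) * (if v \<rightarrow>\<^bsub>G\<^esub> w then 1 else 0)) * x w) = k * x v))"
    (is "?L \<longleftrightarrow> (\<exists>x. ?R x)")
proof -
  let ?n = "length vs"
  define a where "a v w = complex_of_real
          (\<alpha> * (if v = w then real (out_degree G v) else 0)
           + (1 - \<alpha>) * (if v \<rightarrow>\<^bsub>G\<^esub> w then 1 else 0))" for v w
  let ?M = "map_mat complex_of_real (A_alpha \<alpha> vs G)"
  have dim: "?M \<in> carrier_mat ?n ?n"
    by (simp add: A_alpha_def outdegree_mat_def adjacency_mat_def)
  have entry: "?M $$ (i,j) = a (vs ! i) (vs ! j)" if "i < ?n" "j < ?n" for i j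
    using that vs(1)
    by (simp add: A_alpha_def outdegree_mat_def adjacency_mat_def a_def nth_eq_iff_index_eq)
  have bij: "bij_betw ((!) vs) {0..<?n} (verts G)"
    using bij_betw_nth[OF vs(1)] vs(2) by (simp add: atLeast0LessThan)
  have mult: "(?M *\<^sub>v u) $ i = (\<Sum>w\<in>verts G. a (vs ! i) w * x w)"
    if u: "u \<in> carrier_vec ?n" "\<And>j. j < ?n \<Longrightarrow> u $ j = x (vs ! j)" and i: "i < ?n" for u x i
  proof -
    have "(?M *\<^sub>v u) $ i = (\<Sum>j = 0..<?n. ?M $$ (i,j) * u $ j)"
      using dim u(1) i by (simp add: scalar_prod_def)
    also have "\<dots> = (\<Sum>j = 0..<?n. a (vs ! i) (vs ! j) * x (vs ! j))"
      by (rule sum.cong) (use entry i u(2) in auto)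
    also have "\<dots> = (\<Sum>w\<in>verts G. a (vs ! i) w * x w)"
      by (rule sum.reindex_bij_betw[OF bij])
    finally show ?thesis .
  qed
  have key: "eigenvector ?M u k \<longleftrightarrow> ?R x"
    if u: "u \<in> carrier_vec ?n" "\<And>j. j < ?n \<Longrightarrow> u $ j = x (vs ! j)" for u x
  proof -
    have "u \<noteq> 0\<^sub>v ?n \<longleftrightarrow> (\<exists>j<?n. u $ j \<noteq> 0)"
      using u(1) by (auto simp: vec_eq_iff)
    also have "\<dots> \<longleftrightarrow> (\<exists>v\<in>verts G. x v \<noteq> 0)"
      unfolding vs(2)[symmetric] using u(2) by (auto simp: Bex_def in_set_conv_nth)
    finally have nz: "u \<noteq> 0\<^sub>v ?n \<longleftrightarrow> (\<exists>v\<in>verts G. x v \<noteq> 0)" .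
    have "?M *\<^sub>v u = k \<cdot>\<^sub>v u \<longleftrightarrow> (\<forall>i<?n. (?M *\<^sub>v u) $ i = k * u $ i)"
      using u(1) dim by (auto simp: vec_eq_iff)
    also have "\<dots> \<longleftrightarrow> (\<forall>i<?n. (\<Sum>w\<in>verts G. a (vs ! i) w * x w) = k * x (vs ! i))"
      using mult[OF u] u(2) by auto
    also have "\<dots> \<longleftrightarrow> (\<forall>v\<in>verts G. (\<Sum>w\<in>verts G. a v w * x w) = k * x v)"
      unfolding vs(2)[symmetric] by (simp add: all_set_conv_all_nth)
    finally show ?thesis
      using nz u(1) dim unfolding eigenvector_def a_def by auto
  qed
  show ?thesis
  proof
    assume ?L
    then obtain u where u: "eigenvector ?M u k" by (auto simp: eigenvalue_def)
    then have uc: "u \<in> carrier_vec ?n" using dim by (auto simp: eigenvector_def)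
    define x where "x v = u $ (the_inv_into {0..<?n} ((!) vs) v)" for v
    have "u $ j = x (vs ! j)" if "j < ?n" for j
      using that bij by (simp add: x_def the_inv_into_f_f bij_betw_def)
    from key[OF uc this] u have "?R x" by blast
    then show "\<exists>x. ?R x" by (rule exI[of _ x])
  next
    assume "\<exists>x. ?R x"
    then obtain x where x: "?R x" ..
    have "eigenvector ?M (vec ?n (\<lambda>j. x (vs ! j))) k"
      by (subst key[of _ x]) (use x in auto)
    then show ?L by (auto simp: eigenvalue_def)
  qed
qed

lemma lambda_alpha_eq:
  assumes "distinct vs" "set vs = verts G"
  shows "lambda_alpha \<alpha> G = spectral_radius (map_mat complex_of_real (A_alpha \<alpha> vs G))"
proof -
  let ?ws = "SOME vs. distinct vs \<and> set vs = verts G"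
  have ws: "distinct ?ws" "set ?ws = verts G"
    using someI[of "\<lambda>vs. distinct vs \<and> set vs = verts G" vs] assms by auto
  show ?thesis
    unfolding lambda_alpha_def spectral_radius_def spectrum_def
      eigenvalue_A_alpha_iff[OF ws] eigenvalue_A_alpha_iff[OF assms] ..
qed

end

theory Submission
  imports Defs
begin

text \<open>
  Let \<open>\<rho>\<close> be the spectral radius of \<open>B1\<close> and \<open>t = (1 - \<alpha>) / (\<rho> - \<alpha>) < 1\<close>. Its Perron vector is
  constant on each part of the biclique, except at the start of the path, and decays by the factor
  \<open>t\<close> per step of distance along the path. In \<open>G\<close>, strong connectivity gives an arc from a vertex
  \<open>v\<close> of the biclique, in the part \<open>S\<close> say, to a vertex \<open>w\<close> outside it. Weight the biclique like the
  Perron vector, with \<open>v\<close> as the start, and every other vertex \<open>u\<close> by \<open>t\<close> to the power of the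
  distance from \<open>u\<close> to \<open>S\<close>. By parity the distance from \<open>w\<close> is at most \<open>n - p - q\<close>, so this positive
  vector \<open>z\<close> satisfies \<open>A\<^sub>\<alpha> z \<ge> \<rho> z\<close>, which bounds the spectral radius of \<open>G\<close> from below. If
  equality holds then \<open>A\<^sub>\<alpha> z = \<rho> z\<close>, which leaves room for no arc beyond a single path of maximal
  length returning to \<open>S - {v}\<close>. When \<open>S\<close> is the strictly smaller part, a modified weight makes
  the inequality at \<open>v\<close> strict.
\<close>

section \<open>Spectral radius and subsolutions\<close>

text \<open>Spreading the diagonal entry over the out-arcs gives one term per out-neighbour. The
  value type covers both real weights and complex eigenvectors.\<close>

definition A_alpha_op :: "real \<Rightarrow> ('a,'b) pre_digraph \<Rightarrow> ('a \<Rightarrow> 'c::real_vector) \<Rightarrow> 'a \<Rightarrow> 'c" where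
  "A_alpha_op \<alpha> G x v = (\<Sum>w\<in>arcs_ends G `` {v}. \<alpha> *\<^sub>R x v + (1 - \<alpha>) *\<^sub>R x w)"

lemma smult_mat_mult_vec:
  fixes A :: "'a :: comm_semiring_0 mat"
  assumes "A \<in> carrier_mat m n" "x \<in> carrier_vec n"
  shows "(c \<cdot>\<^sub>m A) *\<^sub>v x = c \<cdot>\<^sub>v (A *\<^sub>v x)"
  using assms by (intro eq_vecI) (auto simp: scalar_prod_def sum_distrib_left mult.assoc)

context digraph
begin

section \<open>Out-neighbourhoods and the operator form of \<open>A_alpha\<close>\<close>

lemma out_neighbours_subset: "arcs_ends G `` {v} \<subseteq> verts G"
  using adj_in_verts by auto

lemma finite_out_neighbours [simp]: "finite (arcs_ends G `` {v})"
  using finite_subset[OF out_neighbours_subset] by simp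

lemma out_degree_eq_card: "out_degree G v = card (arcs_ends G `` {v})"
proof -
  have "bij_betw (head G) (out_arcs G v) (arcs_ends G `` {v})"
    unfolding bij_betw_def
  proof
    show "inj_on (head G) (out_arcs G v)"
      by (intro inj_onI no_multi_arcs) (auto simp: out_arcs_def arc_to_ends_def)
    show "head G ` out_arcs G v = arcs_ends G `` {v}"
      by (auto simp: out_arcs_def arcs_ends_conv)
  qed
  then show ?thesis unfolding out_degree_def by (rule bij_betw_same_card)
qed

lemma A_alpha_op_complex:
  assumes v: "v \<in> verts G"
  shows "(\<Sum>w\<in>verts G. complex_of_real
          (\<alpha> * (if v = w then real (out_degree G v) else 0)
           + (1 - \<alpha>) * (if v \<rightarrow>\<^bsub>G\<^esub> w then 1 else 0)) * x w) = A_alpha_op \<alpha> G x v"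
proof -
  have "(\<Sum>w\<in>verts G. complex_of_real
          (\<alpha> * (if v = w then real (out_degree G v) else 0)
           + (1 - \<alpha>) * (if v \<rightarrow>\<^bsub>G\<^esub> w then 1 else 0)) * x w)
     = (\<Sum>w\<in>verts G. if v = w then of_real (\<alpha> * out_degree G v) * x w else 0)
       + (\<Sum>w\<in>verts G. if v \<rightarrow>\<^bsub>G\<^esub> w then of_real (1 - \<alpha>) * x w else 0)"
    unfolding sum.distrib[symmetric] by (rule sum.cong) (auto simp: algebra_simps)
  also have "(\<Sum>w\<in>verts G. if v = w then of_real (\<alpha> * out_degree G v) * x w else 0)
     = of_real (\<alpha> * out_degree G v) * x v"
    using v by (simp add: sum.delta)
  also have "(\<Sum>w\<in>verts G. if v \<rightarrow>\<^bsub>G\<^esub> w then of_real (1 - \<alpha>) * x w else 0)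
     = (\<Sum>w\<in>verts G \<inter> {w. v \<rightarrow>\<^bsub>G\<^esub> w}. of_real (1 - \<alpha>) * x w)"
    by (rule sum.inter_restrict[symmetric, where B = "{w. v \<rightarrow>\<^bsub>G\<^esub> w}", simplified]) simp
  also have "verts G \<inter> {w. v \<rightarrow>\<^bsub>G\<^esub> w} = arcs_ends G `` {v}"
    using out_neighbours_subset[of v] by auto
  finally show ?thesis
    by (simp add: A_alpha_op_def sum.distrib out_degree_eq_card scaleR_conv_of_real)
qed

lemma eigenvalue_A_alpha_iff_op:
  assumes "distinct vs" "set vs = verts G"
  shows "eigenvalue (map_mat complex_of_real (A_alpha \<alpha> vs G)) k \<longleftrightarrow>
    (\<exists>x. (\<exists>v\<in>verts G. x v \<noteq> 0) \<and> (\<forall>v\<in>verts G. A_alpha_op \<alpha> G x v = k * x v))"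
  unfolding eigenvalue_A_alpha_iff[OF assms]
  by (intro ex_cong1 conj_cong refl ball_cong) (simp only: A_alpha_op_complex)

lemma A_alpha_mult_vec:
  fixes x :: "'a \<Rightarrow> complex"
  assumes vs: "distinct vs" "set vs = verts G"
  shows "map_mat complex_of_real (A_alpha \<alpha> vs G) *\<^sub>v vec (length vs) (\<lambda>i. x (vs ! i))
    = vec (length vs) (\<lambda>i. A_alpha_op \<alpha> G x (vs ! i))" (is "?M *\<^sub>v _ = _")
proof (rule eq_vecI)
  fix i assume "i < dim_vec (vec (length vs) (\<lambda>i. A_alpha_op \<alpha> G x (vs ! i)))"
  then have i: "i < length vs" by simp
  define a where "a v w = complex_of_real
          (\<alpha> * (if v = w then real (out_degree G v) else 0)
           + (1 - \<alpha>) * (if v \<rightarrow>\<^bsub>G\<^esub> w then 1 else 0))" for v w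
  have bij: "bij_betw ((!) vs) {0..<length vs} (verts G)"
    using bij_betw_nth[OF vs(1)] vs(2) by (simp add: atLeast0LessThan)
  have "(?M *\<^sub>v vec (length vs) (\<lambda>i. x (vs ! i))) $ i
      = (\<Sum>j = 0..<length vs. ?M $$ (i,j) * x (vs ! j))"
    using i by (simp add: scalar_prod_def A_alpha_def outdegree_mat_def adjacency_mat_def)
  also have "\<dots> = (\<Sum>j = 0..<length vs. a (vs ! i) (vs ! j) * x (vs ! j))"
    using i vs(1) by (intro sum.cong)
      (auto simp: A_alpha_def outdegree_mat_def adjacency_mat_def a_def nth_eq_iff_index_eq)
  also have "\<dots> = (\<Sum>w\<in>verts G. a (vs ! i) w * x w)"
    by (rule sum.reindex_bij_betw[OF bij])
  also have "\<dots> = A_alpha_op \<alpha> G x (vs ! i)"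
    unfolding a_def by (rule A_alpha_op_complex) (use nth_mem[OF i] vs(2) in simp)
  finally show "(?M *\<^sub>v vec (length vs) (\<lambda>i. x (vs ! i))) $ i
      = vec (length vs) (\<lambda>i. A_alpha_op \<alpha> G x (vs ! i)) $ i"
    using i by simp
qed (simp add: A_alpha_def outdegree_mat_def adjacency_mat_def)

section \<open>Bounds on \<open>lambda_alpha\<close> from positive vectors\<close>

lemma lambda_alpha_norm_eigenvalue:
  assumes vs: "distinct vs" "set vs = verts G" and ne: "verts G \<noteq> {}"
  shows "\<exists>k. eigenvalue (map_mat complex_of_real (A_alpha \<alpha> vs G)) k \<and> lambda_alpha \<alpha> G = norm k"
    and "eigenvalue (map_mat complex_of_real (A_alpha \<alpha> vs G)) k \<Longrightarrow> norm k \<le> lambda_alpha \<alpha> G"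
proof -
  have car: "map_mat complex_of_real (A_alpha \<alpha> vs G) \<in> carrier_mat (length vs) (length vs)"
    by (simp add: A_alpha_def outdegree_mat_def adjacency_mat_def)
  have n: "length vs > 0" using vs ne by auto
  show "\<exists>k. eigenvalue (map_mat complex_of_real (A_alpha \<alpha> vs G)) k \<and> lambda_alpha \<alpha> G = norm k"
    using spectral_radius_mem_max(1)[OF car n] unfolding lambda_alpha_eq[OF vs]
    by (auto simp: spectrum_def)
  show "eigenvalue (map_mat complex_of_real (A_alpha \<alpha> vs G)) k \<Longrightarrow> norm k \<le> lambda_alpha \<alpha> G"
    using spectral_radius_mem_max(2)[OF car n] unfolding lambda_alpha_eq[OF vs]
    by (auto simp: spectrum_def)
qed

text \<open>Take an eigenvector \<open>u\<close> for an eigenvalue \<open>k\<close> of largest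
  modulus and the least multiple of \<open>x\<close> that dominates the moduli of \<open>u\<close>.
  At a vertex where the two touch, the triangle inequality gives
  \<open>norm k \<le> \<rho>\<close>.\<close>

lemma lambda_alpha_eqI:
  fixes x :: "'a \<Rightarrow> real"
  assumes \<alpha>: "0 \<le> \<alpha>" "\<alpha> < 1" and ne: "verts G \<noteq> {}"
    and pos: "\<And>v. v \<in> verts G \<Longrightarrow> x v > 0"
    and eig: "\<And>v. v \<in> verts G \<Longrightarrow> A_alpha_op \<alpha> G x v = \<rho> * x v"
  shows "lambda_alpha \<alpha> G = \<rho>"
proof -
  obtain vs where vs: "distinct vs" "set vs = verts G"
    using finite_distinct_list[OF finite_verts] by auto
  obtain v0 where v0: "v0 \<in> verts G" using ne by auto
  have nn: "A_alpha_op \<alpha> G x v \<ge> 0" if "v \<in> verts G" for v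
    unfolding A_alpha_op_def using \<alpha> that
    by (intro sum_nonneg add_nonneg_nonneg scaleR_nonneg_nonneg less_imp_le[OF pos])
       (use adj_in_verts in auto)
  have \<rho>: "\<rho> \<ge> 0" using nn[OF v0] eig[OF v0] pos[OF v0] by (simp add: zero_le_mult_iff)
  have "eigenvalue (map_mat complex_of_real (A_alpha \<alpha> vs G)) (of_real \<rho>)"
    unfolding eigenvalue_A_alpha_iff_op[OF vs]
  proof (intro exI[of _ "\<lambda>v. of_real (x v)"] conjI ballI)
    show "\<exists>v\<in>verts G. complex_of_real (x v) \<noteq> 0" using v0 pos[OF v0] by force
    fix v assume v: "v \<in> verts G"
    have "A_alpha_op \<alpha> G (\<lambda>v. complex_of_real (x v)) v = of_real (A_alpha_op \<alpha> G x v)"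
      by (simp add: A_alpha_op_def scaleR_conv_of_real)
    then show "A_alpha_op \<alpha> G (\<lambda>v. complex_of_real (x v)) v = of_real \<rho> * of_real (x v)"
      using eig[OF v] by simp
  qed
  then have ge: "\<rho> \<le> lambda_alpha \<alpha> G"
    using lambda_alpha_norm_eigenvalue(2)[OF vs ne, of \<alpha> "of_real \<rho>"] \<rho> by simp
  obtain k where k: "lambda_alpha \<alpha> G = norm k"
    and ev: "eigenvalue (map_mat complex_of_real (A_alpha \<alpha> vs G)) k"
    using lambda_alpha_norm_eigenvalue(1)[OF vs ne, of \<alpha>] by blast
  from ev obtain u where u: "\<exists>v\<in>verts G. u v \<noteq> 0"
    "\<And>v. v \<in> verts G \<Longrightarrow> A_alpha_op \<alpha> G u v = k * u v"
    unfolding eigenvalue_A_alpha_iff_op[OF vs] by blast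
  define M where "M = Max ((\<lambda>v. norm (u v) / x v) ` verts G)"
  have "M \<in> (\<lambda>v. norm (u v) / x v) ` verts G" unfolding M_def using ne by (intro Max_in) auto
  then obtain v where v: "v \<in> verts G" and Mv: "M = norm (u v) / x v" by auto
  have M: "norm (u w) \<le> M * x w" if "w \<in> verts G" for w
  proof -
    have "norm (u w) / x w \<le> M" unfolding M_def using that by (intro Max_ge) auto
    then show ?thesis using pos[OF that] by (simp add: divide_le_eq)
  qed
  have Mpos: "M > 0"
  proof -
    obtain w where w: "w \<in> verts G" "u w \<noteq> 0" using u by auto
    have "0 < norm (u w)" using w by simp
    then have "0 < M * x w" using M[OF w(1)] by linarith
    then show ?thesis using pos[OF w(1)] by (simp add: zero_less_mult_iff)
  qed
  have "norm k * (M * x v) = norm (A_alpha_op \<alpha> G u v)"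
    using u(2)[OF v] Mv pos[OF v] by (simp add: norm_mult)
  also have "\<dots> \<le> (\<Sum>w\<in>arcs_ends G `` {v}. \<alpha> * (M * x v) + (1 - \<alpha>) * (M * x w))"
    unfolding A_alpha_op_def
  proof (rule sum_norm_le)
    fix w assume "w \<in> arcs_ends G `` {v}"
    then have w: "w \<in> verts G" using adj_in_verts by auto
    have "norm (\<alpha> *\<^sub>R u v + (1 - \<alpha>) *\<^sub>R u w) \<le> \<alpha> * norm (u v) + (1 - \<alpha>) * norm (u w)"
      using norm_triangle_ineq[of "\<alpha> *\<^sub>R u v" "(1 - \<alpha>) *\<^sub>R u w"] \<alpha> by simp
    also have "\<dots> \<le> \<alpha> * (M * x v) + (1 - \<alpha>) * (M * x w)"
      using \<alpha> M[OF v] M[OF w] by (intro add_mono mult_left_mono) auto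
    finally show "norm (\<alpha> *\<^sub>R u v + (1 - \<alpha>) *\<^sub>R u w) \<le> \<alpha> * (M * x v) + (1 - \<alpha>) * (M * x w)" .
  qed
  also have "\<dots> = M * A_alpha_op \<alpha> G x v"
    by (simp add: A_alpha_op_def sum_distrib_left algebra_simps)
  also have "\<dots> = \<rho> * (M * x v)" using eig[OF v] by simp
  finally have "norm k \<le> \<rho>" using Mpos pos[OF v] by simp
  with ge k show ?thesis by simp
qed

lemma A_alpha_op_mono:
  fixes x y :: "'a \<Rightarrow> real"
  assumes "0 \<le> \<alpha>" "\<alpha> < 1" "\<And>w. w \<in> verts G \<Longrightarrow> x w \<le> y w" "v \<in> verts G"
  shows "A_alpha_op \<alpha> G x v \<le> A_alpha_op \<alpha> G y v"
  unfolding A_alpha_op_def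
proof (rule sum_mono)
  fix w assume "w \<in> arcs_ends G `` {v}"
  then have "w \<in> verts G" using out_neighbours_subset by blast
  then show "\<alpha> *\<^sub>R x v + (1 - \<alpha>) *\<^sub>R x w \<le> \<alpha> *\<^sub>R y v + (1 - \<alpha>) *\<^sub>R y w"
    using assms by (intro add_mono scaleR_left_mono) auto
qed

lemma A_alpha_op_scale:
  "A_alpha_op \<alpha> G (\<lambda>v. c * x v :: real) v = c * A_alpha_op \<alpha> G x v"
  unfolding A_alpha_op_def sum_distrib_left by (rule sum.cong) (simp_all add: algebra_simps)

text \<open>
  If the spectral radius were below \<open>r < \<rho>\<close>, the powers of \<open>A_alpha / r\<close> would be bounded,
  yet they stretch \<open>z\<close> at least by the powers of \<open>\<rho> / r\<close>.
\<close>

lemma lambda_alpha_geI: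
  fixes z :: "'a \<Rightarrow> real"
  assumes \<alpha>: "0 \<le> \<alpha>" "\<alpha> < 1" and ne: "verts G \<noteq> {}"
    and pos: "\<And>v. v \<in> verts G \<Longrightarrow> z v > 0"
    and sub: "\<And>v. v \<in> verts G \<Longrightarrow> \<rho> * z v \<le> A_alpha_op \<alpha> G z v"
  shows "\<rho> \<le> lambda_alpha \<alpha> G"
proof (rule ccontr)
  assume "\<not> ?thesis"
  then obtain r where r: "lambda_alpha \<alpha> G < r" "r < \<rho>" using dense[of "lambda_alpha \<alpha> G" \<rho>] by auto
  obtain vs where vs: "distinct vs" "set vs = verts G"
    using finite_distinct_list[OF finite_verts] by auto
  obtain k0 where "lambda_alpha \<alpha> G = norm (k0 :: complex)"
    using lambda_alpha_norm_eigenvalue(1)[OF vs ne, of \<alpha>] by blast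
  then have r0: "r > 0" using r(1) norm_ge_zero[of k0] by linarith
  let ?n = "length vs"
  define A where "A = map_mat complex_of_real (A_alpha \<alpha> vs G)"
  define C where "C = of_real (1/r) \<cdot>\<^sub>m A"
  have A: "A \<in> carrier_mat ?n ?n"
    by (simp add: A_def A_alpha_def outdegree_mat_def adjacency_mat_def)
  have C: "C \<in> carrier_mat ?n ?n" unfolding C_def using A by simp
  have n: "?n > 0" using vs ne by auto
  have "spectral_radius C < 1"
  proof -
    obtain k where k: "eigenvalue C k" "spectral_radius C = norm k"
      using spectral_radius_mem_max(1)[OF C n] by (auto simp: spectrum_def)
    then obtain u where u: "u \<in> carrier_vec ?n" "u \<noteq> 0\<^sub>v ?n" "C *\<^sub>v u = k \<cdot>\<^sub>v u"
      using C by (auto simp: eigenvalue_def eigenvector_def)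
    have "A = of_real r \<cdot>\<^sub>m C" unfolding C_def using r0 by (intro eq_matI) auto
    then have "A *\<^sub>v u = of_real r \<cdot>\<^sub>v (C *\<^sub>v u)"
      by (simp add: smult_mat_mult_vec[OF C u(1)])
    also have "\<dots> = (of_real r * k) \<cdot>\<^sub>v u" by (simp add: u(3) smult_smult_assoc)
    finally have "eigenvalue A (of_real r * k)"
      using u A unfolding eigenvalue_def eigenvector_def by auto
    from lambda_alpha_norm_eigenvalue(2)[OF vs ne this[unfolded A_def]]
    have "r * norm k \<le> lambda_alpha \<alpha> G" using r0 by (simp add: norm_mult)
    then have "r * norm k < r * 1" using r by linarith
    then show ?thesis using r0 k(2) by simp
  qed
  from spectral_radius_jnf_norm_bound_less_1_upper_triangular[OF C this]
  obtain c where c: "\<And>m. norm_bound (C ^\<^sub>m m) c" by auto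
  \<comment> \<open>\<open>T\<close> is the action of \<open>C\<close> on real weights and
    \<open>h\<close> embeds these as complex vectors: growth is estimated over the reals,
    boundedness on the powers of \<open>C\<close>.\<close>
  define T where "T x v = A_alpha_op \<alpha> G x v / r" for x :: "'a \<Rightarrow> real" and v
  define h where "h x = vec ?n (\<lambda>i. complex_of_real (x (vs ! i)))" for x :: "'a \<Rightarrow> real"
  have Ch: "C *\<^sub>v h x = h (T x)" for x
  proof -
    have "C *\<^sub>v h x = of_real (1/r) \<cdot>\<^sub>v (A *\<^sub>v h x)"
      unfolding C_def by (rule smult_mat_mult_vec[OF A]) (simp add: h_def)
    also have "A *\<^sub>v h x = vec ?n (\<lambda>i. A_alpha_op \<alpha> G (\<lambda>v. complex_of_real (x v)) (vs ! i))"
      unfolding A_def h_def by (rule A_alpha_mult_vec[OF vs])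
    finally show ?thesis unfolding h_def T_def
      by (intro eq_vecI) (auto simp: A_alpha_op_def scaleR_conv_of_real)
  qed
  have pow: "C ^\<^sub>m m *\<^sub>v h x = h ((T ^^ m) x)" for m x
  proof (induction m arbitrary: x)
    case 0
    then show ?case using C by (simp add: h_def)
  next
    case (Suc m)
    have "C ^\<^sub>m Suc m *\<^sub>v h x = C ^\<^sub>m m *\<^sub>v (C *\<^sub>v h x)"
      using C by (simp add: assoc_mult_mat_vec[of _ ?n ?n _ ?n] h_def)
    also have "\<dots> = h ((T ^^ m) (T x))" unfolding Ch by (rule Suc.IH)
    finally show ?case by (simp add: funpow_Suc_right del: funpow.simps)
  qed
  have growth: "(\<rho> / r) ^ m * z v \<le> (T ^^ m) z v" if "v \<in> verts G" for m v
    using that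
  proof (induction m arbitrary: v)
    case (Suc m)
    have "(\<rho> / r) ^ Suc m * z v = (\<rho> / r) ^ m * (\<rho> * z v) / r" by simp
    also have "\<dots> \<le> (\<rho> / r) ^ m * A_alpha_op \<alpha> G z v / r"
      using sub[OF Suc.prems] r r0 by (intro divide_right_mono mult_left_mono) auto
    also have "\<dots> = A_alpha_op \<alpha> G (\<lambda>v. (\<rho> / r) ^ m * z v) v / r"
      by (simp add: A_alpha_op_scale)
    also have "\<dots> \<le> T ((T ^^ m) z) v"
      unfolding T_def[of "(T ^^ m) z"]
      using Suc r0 \<alpha> by (intro divide_right_mono A_alpha_op_mono) auto
    finally show ?case by simp
  qed simp
  \<comment> \<open>The entry at one vertex suffices: it grows geometrically, while the bounded
    entries in row 0 of the powers of \<open>C\<close> keep it below a constant.\<close>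
  have bound: "(\<rho> / r) ^ m * z (vs ! 0) \<le> (\<Sum>j<?n. c * z (vs ! j))" for m
  proof -
    have v0: "vs ! 0 \<in> verts G" using nth_mem[OF n] vs(2) by simp
    have "(\<rho> / r) ^ m * z (vs ! 0) \<le> norm (complex_of_real ((T ^^ m) z (vs ! 0)))"
      unfolding norm_of_real using growth[OF v0, of m] abs_ge_self by (rule order_trans)
    also have "\<dots> = norm ((C ^\<^sub>m m *\<^sub>v h z) $ 0)"
      unfolding pow using n by (simp add: h_def)
    also have "\<dots> = norm (\<Sum>j<?n. (C ^\<^sub>m m) $$ (0,j) * of_real (z (vs ! j)))"
      using n C pow_carrier_mat[OF C, of m]
      by (simp add: scalar_prod_def h_def atLeast0LessThan)
    also have "\<dots> \<le> (\<Sum>j<?n. c * z (vs ! j))"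
    proof (rule sum_norm_le)
      fix j assume "j \<in> {..<?n}"
      then have j: "j < ?n" by simp
      have "norm ((C ^\<^sub>m m) $$ (0,j)) \<le> c"
        using c[of m] j n unfolding norm_bound_def carrier_matD[OF pow_carrier_mat[OF C]] by simp
      moreover have "z (vs ! j) > 0" using nth_mem[OF j] vs(2) pos by simp
      ultimately show "norm ((C ^\<^sub>m m) $$ (0,j) * of_real (z (vs ! j))) \<le> c * z (vs ! j)"
        by (simp add: norm_mult)
    qed
    finally show ?thesis .
  qed
  have "1 < \<rho> / r" using r r0 by simp
  then obtain m where "(\<Sum>j<?n. c * z (vs ! j)) / z (vs ! 0) < (\<rho> / r) ^ m"
    using real_arch_pow by blast
  moreover have "z (vs ! 0) > 0" using nth_mem[OF n] vs(2) pos by simp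
  ultimately show False using bound[of m] by (simp add: divide_less_eq)
qed

text \<open>Call a vertex tight if equality holds there. Strong connectivity supplies an arc from a
  tight vertex to a strict one, whose tail can be made strict without creating tight vertices. Once
  none is tight, the least ratio \<open>\<mu>\<close> of image to weight exceeds
  \<open>\<rho>\<close>, and \<open>lambda_alpha_geI\<close> applies to it.\<close>

lemma lambda_alpha_gtI:
  fixes z :: "'a \<Rightarrow> real"
  assumes \<alpha>: "0 \<le> \<alpha>" "\<alpha> < 1" and sc: "strongly_connected G"
    and "\<And>v. v \<in> verts G \<Longrightarrow> z v > 0"
    and "\<And>v. v \<in> verts G \<Longrightarrow> \<rho> * z v \<le> A_alpha_op \<alpha> G z v"
    and "v0 \<in> verts G" "\<rho> * z v0 < A_alpha_op \<alpha> G z v0"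
  shows "\<rho> < lambda_alpha \<alpha> G"
  using assms(4-)
proof (induction "card {v \<in> verts G. A_alpha_op \<alpha> G z v \<le> \<rho> * z v}" arbitrary: z v0
    rule: less_induct)
  case less
  note pos = less.prems(1) and sub = less.prems(2) and v0 = less.prems(3,4)
  show ?case
  proof (cases "\<exists>v\<in>verts G. A_alpha_op \<alpha> G z v \<le> \<rho> * z v")
    case False
    define \<mu> where "\<mu> = Min ((\<lambda>v. A_alpha_op \<alpha> G z v / z v) ` verts G)"
    have ne: "verts G \<noteq> {}" using v0 by auto
    have "\<mu> \<in> (\<lambda>v. A_alpha_op \<alpha> G z v / z v) ` verts G" unfolding \<mu>_def using ne by (intro Min_in) auto
    then have "\<rho> < \<mu>" using False pos by (auto simp: less_divide_eq)
    also have "\<mu> \<le> lambda_alpha \<alpha> G"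
    proof (rule lambda_alpha_geI[OF \<alpha> ne pos])
      fix v assume v: "v \<in> verts G"
      have "\<mu> \<le> A_alpha_op \<alpha> G z v / z v" unfolding \<mu>_def using v by (intro Min_le) auto
      then show "\<mu> * z v \<le> A_alpha_op \<alpha> G z v" using pos[OF v] by (simp add: le_divide_eq)
    qed
    finally show ?thesis .
  next
    case True
    then obtain u where u: "u \<in> verts G" "A_alpha_op \<alpha> G z u \<le> \<rho> * z u" by auto
    have "u \<rightarrow>\<^sup>*\<^bsub>G\<^esub> v0" using sc u v0 by (auto simp: strongly_connected_def)
    \<comment> \<open>On a walk from the tight vertex \<open>u\<close> to the strict vertex
      \<open>v0\<close>, some arc passes from tight to strict. Tightness of the start is a premise
      inside the formula so that it varies in the induction.\<close>
    then have "A_alpha_op \<alpha> G z u \<le> \<rho> * z u \<longrightarrow> (\<exists>v w. v \<rightarrow>\<^bsub>G\<^esub> w \<and>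
        A_alpha_op \<alpha> G z v \<le> \<rho> * z v \<and> \<rho> * z w < A_alpha_op \<alpha> G z w)"
    proof (induction rule: converse_reachable_induct)
      case base
      then show ?case using v0 by auto
    next
      case (step x y)
      then show ?case by (metis not_le)
    qed
    then obtain v w where vw: "v \<rightarrow>\<^bsub>G\<^esub> w" "A_alpha_op \<alpha> G z v \<le> \<rho> * z v"
      "\<rho> * z w < A_alpha_op \<alpha> G z w" using u by auto
    have v: "v \<in> verts G" and w: "w \<in> verts G" using vw adj_in_verts by auto
    \<comment> \<open>Adding the image under the operator propagates strictness from w to v.\<close>
    define r where "r x = A_alpha_op \<alpha> G z x - \<rho> * z x" for x
    define z' where "z' x = z x + A_alpha_op \<alpha> G z x" for x
    have r0: "r x \<ge> 0" if "x \<in> verts G" for x using sub[OF that] by (simp add: r_def)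
    \<comment> \<open>By linearity, the residual of \<open>z'\<close> is the residual
      \<open>r\<close> of \<open>z\<close> plus the image of \<open>r\<close>.\<close>
    have r': "A_alpha_op \<alpha> G z' x - \<rho> * z' x = r x + A_alpha_op \<alpha> G r x" for x
    proof -
      have "A_alpha_op \<alpha> G z' x = A_alpha_op \<alpha> G z x + A_alpha_op \<alpha> G (A_alpha_op \<alpha> G z) x"
        unfolding z'_def A_alpha_op_def[of _ _ _ x] sum.distrib[symmetric] 
        by (rule sum.cong) (auto simp: algebra_simps)
      moreover have "A_alpha_op \<alpha> G r x = A_alpha_op \<alpha> G (A_alpha_op \<alpha> G z) x - \<rho> * A_alpha_op \<alpha> G z x"
        unfolding r_def A_alpha_op_def[of _ _ _ x] sum_distrib_left sum_subtractf[symmetric] 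
        by (rule sum.cong) (auto simp: algebra_simps)
      ultimately show ?thesis by (simp add: r_def z'_def algebra_simps)
    qed
    have term0: "0 \<le> \<alpha> *\<^sub>R r x + (1 - \<alpha>) *\<^sub>R r y" if "x \<in> verts G" "x \<rightarrow>\<^bsub>G\<^esub> y" for x y
      using r0 that \<alpha> adj_in_verts(2)[OF that(2)] by simp
    have op0: "A_alpha_op \<alpha> G r x \<ge> 0" if "x \<in> verts G" for x
      unfolding A_alpha_op_def using that by (intro sum_nonneg term0) auto
    have opv: "A_alpha_op \<alpha> G r v > 0"
      unfolding A_alpha_op_def
    proof (rule sum_pos2[of _ w])
      have "r w > 0" using vw by (simp add: r_def)
      then show "0 < \<alpha> *\<^sub>R r v + (1 - \<alpha>) *\<^sub>R r w" using r0[OF v] \<alpha>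
        by (simp add: add_nonneg_pos)
    qed (use vw v term0 in auto)
    show ?thesis
    proof (rule less.hyps[of z' v])
      have "{v \<in> verts G. A_alpha_op \<alpha> G z' v \<le> \<rho> * z' v} \<subseteq> {v \<in> verts G. A_alpha_op \<alpha> G z v \<le> \<rho> * z v} - {v}"
      proof
        fix x assume x: "x \<in> {v \<in> verts G. A_alpha_op \<alpha> G z' v \<le> \<rho> * z' v}"
        then have "r x + A_alpha_op \<alpha> G r x \<le> 0" using r'[of x] by simp
        then show "x \<in> {v \<in> verts G. A_alpha_op \<alpha> G z v \<le> \<rho> * z v} - {v}"
          using x r0[of x] op0[of x] opv by (auto simp: r_def)
      qed
      also have "\<dots> \<subset> {v \<in> verts G. A_alpha_op \<alpha> G z v \<le> \<rho> * z v}" using v vw by auto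
      finally show "card {v \<in> verts G. A_alpha_op \<alpha> G z' v \<le> \<rho> * z' v}
          < card {v \<in> verts G. A_alpha_op \<alpha> G z v \<le> \<rho> * z v}"
        by (intro psubset_card_mono) auto
      show "v \<in> verts G" by (rule v)
      show "\<rho> * z' v < A_alpha_op \<alpha> G z' v" using r'[of v] opv r0[OF v] by simp
    next
      fix x assume x: "x \<in> verts G"
      show "\<rho> * z' x \<le> A_alpha_op \<alpha> G z' x" using r'[of x] op0[OF x] r0[OF x] by simp
      have "A_alpha_op \<alpha> G (\<lambda>_. 0 :: real) x \<le> A_alpha_op \<alpha> G z x"
        using pos x \<alpha> by (intro A_alpha_op_mono) (auto intro: less_imp_le)
      then show "0 < z' x" using pos[OF x] by (simp add: z'_def A_alpha_op_def)
    qed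
  qed
qed

end

section \<open>The extremal digraph\<close>

lemma set_vwalk_arcs_upt: "set (vwalk_arcs [a..<b]) = {(i, Suc i) | i. a \<le> i \<and> Suc i < b}"
proof (induction b)
  case (Suc b)
  show ?case
  proof (cases "a < b")
    case True
    then have "set (vwalk_arcs [a..<Suc b]) = insert (b - 1, b) {(i, Suc i) | i. a \<le> i \<and> Suc i < b}"
      using Suc.IH by (simp add: set_vwalk_arcs_snoc)
    also have "\<dots> = {(i, Suc i) | i. a \<le> i \<and> Suc i < Suc b}"
    proof -
      have "Suc i = b" if "Suc i < Suc b" "\<not> Suc i < b" for i using that by linarith
      then show ?thesis using True by (fastforce simp: less_Suc_eq)
    qed
    finally show ?thesis .
  qed (cases "a = b"; auto)
qed simp

lemma arcs_ends_B1:
  assumes "p + q < n"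
  shows "arcs_ends (with_proj (B1 n p q)) = {1..p} \<times> {p+1..p+q} \<union> {p+1..p+q} \<times> {1..p}
    \<union> {(1, p+q+1), (n, p)} \<union> {(i, Suc i) | i. p + q < i \<and> i < n}"
proof -
  have "set (vwalk_arcs (1 # [p+q+1..<n+1] @ [p]))
      = insert (1, p+q+1) (insert (n, p) (set (vwalk_arcs [p+q+1..<n+1])))"
    using assms by (simp add: set_vwalk_arcs_snoc upt_conv_Cons[of "Suc (p+q)" n]
        del: upt_Suc vwalk_arcs.simps)
  moreover have "{(i, Suc i) | i. p+q+1 \<le> i \<and> Suc i < n+1} = {(i, Suc i) | i. p + q < i \<and> i < n}"
    by auto
  ultimately have "set (vwalk_arcs (1 # [p+q+1..<n+1] @ [p]))
      = {(1, p+q+1), (n, p)} \<union> {(i, Suc i) | i. p + q < i \<and> i < n}"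
    unfolding set_vwalk_arcs_upt by blast
  then have "parcs (B1 n p q) = ({1..p} \<times> {p+1..p+q} \<union> {p+1..p+q} \<times> {1..p})
    \<union> ({(1, p+q+1), (n, p)} \<union> {(i, Suc i) | i. p + q < i \<and> i < n})"
    by (simp only: B1_def K_bip_def pair_pre_digraph.simps)
  then show ?thesis by (simp only: with_proj_simps Un_assoc)
qed

lemma out_neighbours_B1:
  assumes "p + q < n" "2 \<le> p" "1 \<le> q"
  defines "N i \<equiv> arcs_ends (with_proj (B1 n p q)) `` {i}"
  shows "N 1 = insert (p+q+1) {p+1..p+q}"
    and "\<lbrakk>1 < i; i \<le> p\<rbrakk> \<Longrightarrow> N i = {p+1..p+q}"
    and "\<lbrakk>p < i; i \<le> p + q\<rbrakk> \<Longrightarrow> N i = {1..p}"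
    and "\<lbrakk>p + q < i; i < n\<rbrakk> \<Longrightarrow> N i = {Suc i}"
    and "N n = {p}"
  using assms(1-3) unfolding N_def arcs_ends_B1[OF assms(1)] by auto

lemma verts_B1: "p + q \<le> n \<Longrightarrow> verts (with_proj (B1 n p q)) = {1..n}"
  by (auto simp: B1_def K_bip_def)

lemma digraph_B1:
  assumes "p + q < n" "2 \<le> p" "1 \<le> q"
  shows "digraph (with_proj (B1 n p q))"
proof -
  have arcs: "parcs (B1 n p q) = {1..p} \<times> {p+1..p+q} \<union> {p+1..p+q} \<times> {1..p}
    \<union> {(1, p+q+1), (n, p)} \<union> {(i, Suc i) | i. p + q < i \<and> i < n}"
    using arcs_ends_B1[OF assms(1)] by simp
  have verts: "pverts (B1 n p q) = {1..n}" using verts_B1 assms(1) by simp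
  have sub: "parcs (B1 n p q) \<subseteq> {1..n} \<times> {1..n}" unfolding arcs using assms by auto
  have "finite (parcs (B1 n p q))" by (rule finite_subset[OF sub]) simp
  then have "pair_digraph (B1 n p q)"
    using sub assms(1) by unfold_locales (auto simp: verts, auto simp: arcs)
  then interpret pair_digraph "B1 n p q" .
  show ?thesis by (rule digraph_axioms)
qed

text \<open>The vector \<open>x\<close> below is a positive eigenvector, so
  \<open>lambda_alpha_eqI\<close> applies. The equations \<open>eqS\<close>, \<open>eqv\<close> and
  \<open>eqT\<close> are the eigenvalue conditions at the vertices 2 to \<open>p\<close>, at vertex
  1 and on the part of size \<open>q\<close>; the choice of \<open>t\<close> is the condition along
  the path.\<close>

lemma lambda_alpha_B1:
  fixes b y \<rho> \<alpha> :: real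
  assumes \<alpha>: "0 \<le> \<alpha>" "\<alpha> < 1" and n: "p + q < n" "2 \<le> p" "1 \<le> q"
    and \<rho>: "\<alpha> < \<rho>" and pos: "b > 0" "y > 0" and t: "t = (1 - \<alpha>) / (\<rho> - \<alpha>)"
    and eqS: "\<rho> - \<alpha> * q = (1 - \<alpha>) * (q * y)"
    and eqv: "(\<rho> - \<alpha> * q - \<alpha>) * b = (1 - \<alpha>) * (q * y + t ^ (n - p - q))"
    and eqT: "(\<rho> - \<alpha> * p) * y = (1 - \<alpha>) * (real p - 1 + b)"
  shows "lambda_alpha \<alpha> (with_proj (B1 n p q)) = \<rho>"
proof -
  let ?B = "with_proj (B1 n p q)"
  interpret digraph ?B by (rule digraph_B1[OF n])
  \<comment> \<open>The exponent is the distance from the path vertex \<open>i\<close> to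
    \<open>p\<close>: vertex \<open>n\<close> gets \<open>t\<close>, and its successor
    \<open>p\<close> has weight 1.\<close>
  define x where "x i = (if i = 1 then b else if i \<le> p then 1 else if i \<le> p + q then y
    else t ^ (n + 1 - i))" for i :: nat
  have t0: "t > 0" using \<alpha> \<rho> by (simp add: t)
  have t1: "\<alpha> * t + (1 - \<alpha>) = \<rho> * t" using \<rho> by (simp add: t field_simps)
  have verts: "verts ?B = {1..n}" using verts_B1 n by simp
  show ?thesis
  proof (rule lambda_alpha_eqI[OF \<alpha>, of x])
    show "verts ?B \<noteq> {}" unfolding verts using n by simp
    show "x v > 0" for v using pos t0 by (simp add: x_def)
    fix i assume "i \<in> verts ?B"
    then have i: "1 \<le> i" "i \<le> n" unfolding verts by auto
    note N = out_neighbours_B1[OF n]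
    consider "i = 1" | "1 < i" "i \<le> p" | "p < i" "i \<le> p + q" | "p + q < i" "i < n" | "i = n"
      using i by linarith
    then show "A_alpha_op \<alpha> ?B x i = \<rho> * x i"
    proof cases
      case 1
      have "A_alpha_op \<alpha> ?B x i = (\<alpha> * b + (1 - \<alpha>) * t ^ (n - p - q)) + q * (\<alpha> * b + (1 - \<alpha>) * y)"
        using n unfolding A_alpha_op_def 1 N(1) by (simp add: x_def algebra_simps)
      then show ?thesis using eqv 1 by (simp add: x_def algebra_simps)
    next
      case 2
      have "A_alpha_op \<alpha> ?B x i = q * (\<alpha> + (1 - \<alpha>) * y)"
        using n 2 unfolding A_alpha_op_def N(2)[OF 2] by (simp add: x_def)
      then show ?thesis using eqS 2 by (simp add: x_def algebra_simps)
    next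
      case 3
      have "{1..p} = insert 1 {2..p}" using n by auto
      then have "A_alpha_op \<alpha> ?B x i = (\<alpha> * y + (1 - \<alpha>) * b) + (\<Sum>w\<in>{2..p}. \<alpha> * y + (1 - \<alpha>) * x w)"
        using n 3 unfolding A_alpha_op_def N(3)[OF 3] by (simp add: x_def algebra_simps)
      also have "(\<Sum>w\<in>{2..p}. \<alpha> * y + (1 - \<alpha>) * x w) = (\<Sum>w\<in>{2..p}. \<alpha> * y + (1 - \<alpha>))"
        by (rule sum.cong) (auto simp: x_def)
      also have "\<dots> = (real p - 1) * (\<alpha> * y + (1 - \<alpha>))" using n by (simp add: of_nat_diff)
      finally have "A_alpha_op \<alpha> ?B x i = \<rho> * y" using eqT by (simp add: algebra_simps)
      then show ?thesis using 3 n by (simp add: x_def)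
    next
      case 4
      have e: "Suc n - i = Suc (n - i)" using 4 by (simp add: Suc_diff_le)
      have "A_alpha_op \<alpha> ?B x i = (\<alpha> * t + (1 - \<alpha>)) * t ^ (n - i)"
        using n 4 unfolding A_alpha_op_def N(4)[OF 4] by (simp add: x_def e algebra_simps)
      then show ?thesis unfolding t1 using 4 n by (simp add: x_def e algebra_simps)
    next
      case 5
      have "A_alpha_op \<alpha> ?B x i = \<alpha> * t + (1 - \<alpha>)"
        using n unfolding A_alpha_op_def 5 N(5) by (simp add: x_def)
      then show ?thesis unfolding t1 using 5 n by (simp add: x_def)
    qed
  qed
qed

text \<open>Eliminating \<open>b\<close> and \<open>y\<close> from the three conditions of
  \<open>lambda_alpha_B1\<close> leaves this equation, with \<open>k\<close> the number of vertices
  outside the biclique. The lower bounds on \<open>\<rho>\<close> keep the resulting values positive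
  and make \<open>t < 1\<close>. The root comes from the intermediate value theorem.\<close>

lemma B1_char_eq_root:
  fixes \<alpha> p q :: real
  assumes \<alpha>: "0 \<le> \<alpha>" "\<alpha> < 1" and pq: "1 \<le> q" "q \<le> p"
  shows "\<exists>\<rho>>1. \<alpha> * p < \<rho> \<and> \<alpha> * (q + 1) < \<rho> \<and>
    (\<rho> - \<alpha> * p) * (\<rho> - \<alpha> * q) * (\<rho> - \<alpha> * q - \<alpha>) = (1 - \<alpha>)\<^sup>2 *
      (p * q * (\<rho> - \<alpha> * q - \<alpha>) + q * (\<alpha> + (1 - \<alpha>) * ((1 - \<alpha>) / (\<rho> - \<alpha>)) ^ k))"
proof -
  define l where "l = max 1 (max (\<alpha> * p) (\<alpha> * (q + 1)))"
  define h where "h \<rho> = q * (\<alpha> + (1 - \<alpha>) * ((1 - \<alpha>) / (\<rho> - \<alpha>)) ^ k)" for \<rho>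
  define F where "F \<rho> = (\<rho> - \<alpha> * p) * (\<rho> - \<alpha> * q) * (\<rho> - \<alpha> * q - \<alpha>)
    - (1 - \<alpha>)\<^sup>2 * (p * q * (\<rho> - \<alpha> * q - \<alpha>) + h \<rho>)" for \<rho>
  have h0: "h \<rho> > 0" if "1 \<le> \<rho>" for \<rho>
    unfolding h_def using \<alpha> pq that by (intro mult_pos_pos add_nonneg_pos) auto
  have neg: "F l < 0"
  proof -
    have l: "1 \<le> l" "\<alpha> * p \<le> l" "\<alpha> * (q + 1) \<le> l" by (auto simp: l_def)
    have Q: "0 \<le> l - \<alpha> * q - \<alpha>" using l by (simp add: algebra_simps)
    have rhs: "0 \<le> (1 - \<alpha>)\<^sup>2 * (p * q * (l - \<alpha> * q - \<alpha>))" using Q pq by simp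
    \<comment> \<open>At the largest of the three lower bounds the left side vanishes or, for
      \<open>l = 1\<close>, has its first two factors at most \<open>1 - \<alpha>\<close>; the term
      \<open>h l\<close> then makes \<open>F l\<close> negative.\<close>
    consider "l = 1" | "l = \<alpha> * p" | "l = \<alpha> * (q + 1)" unfolding l_def by linarith
    then have "(l - \<alpha> * p) * (l - \<alpha> * q) * (l - \<alpha> * q - \<alpha>) \<le> (1 - \<alpha>)\<^sup>2 * (p * q * (l - \<alpha> * q - \<alpha>))"
    proof cases
      case 1
      have "\<alpha> * 1 \<le> \<alpha> * p" "\<alpha> * 1 \<le> \<alpha> * q" using \<alpha> pq by (intro mult_left_mono; simp)+
      then have "(l - \<alpha> * p) * (l - \<alpha> * q) \<le> (1 - \<alpha>) * (1 - \<alpha>)"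
        using 1 l Q \<alpha> by (intro mult_mono) auto
      also have "\<dots> \<le> (1 - \<alpha>)\<^sup>2 * (p * q)"
        using pq mult_mono[of 1 p 1 q] mult_left_mono[of 1 "p * q" "(1 - \<alpha>)\<^sup>2"]
        by (simp add: power2_eq_square)
      finally have "(l - \<alpha> * p) * (l - \<alpha> * q) * (l - \<alpha> * q - \<alpha>) \<le> (1 - \<alpha>)\<^sup>2 * (p * q) * (l - \<alpha> * q - \<alpha>)"
        using Q by (rule mult_right_mono)
      then show ?thesis by (simp only: mult.assoc)
    next
      case 2
      then show ?thesis using rhs by simp
    next
      case 3
      then have "l - \<alpha> * q - \<alpha> = 0" by (simp add: algebra_simps)
      then show ?thesis by simp
    qed
    moreover have "(1 - \<alpha>)\<^sup>2 * h l > 0" using h0[OF l(1)] \<alpha> by simp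
    ultimately show ?thesis unfolding F_def by (simp add: distrib_left)
  qed
  \<comment> \<open>This choice gives \<open>u - \<alpha> * p \<ge> q + 2\<close> and
    \<open>u - \<alpha> * q \<ge> p + 2\<close>, enough to dominate the right side even with its
    factor \<open>(1 - \<alpha>)\<^sup>2\<close> replaced by 1.\<close>
  define u where "u = p + q + 2"
  have posF: "F u > 0"
  proof -
    have ap: "\<alpha> * p \<le> p" "\<alpha> * q \<le> q" using \<alpha> pq by (auto intro: mult_left_le_one_le)
    have "1 \<le> u" using pq by (simp add: u_def)
    have Q: "u - \<alpha> * q - \<alpha> > q" using ap \<alpha> pq unfolding u_def by linarith
    have "(1 - \<alpha>) / (u - \<alpha>) \<le> 1" "0 \<le> (1 - \<alpha>) / (u - \<alpha>)" using \<alpha> pq by (auto simp: u_def)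
    then have "((1 - \<alpha>) / (u - \<alpha>)) ^ k \<le> 1" by (rule power_le_one[rotated])
    then have "(1 - \<alpha>) * ((1 - \<alpha>) / (u - \<alpha>)) ^ k \<le> (1 - \<alpha>) * 1" using \<alpha> by (intro mult_left_mono) auto
    then have "h u \<le> q * 1" unfolding h_def using pq by (intro mult_left_mono) auto
    then have *: "p * q * (u - \<alpha> * q - \<alpha>) + h u < (p * q + 1) * (u - \<alpha> * q - \<alpha>)"
      using Q by (simp add: distrib_right)
    have "(1 - \<alpha>)\<^sup>2 \<le> 1" using \<alpha> by (simp add: power_le_one)
    moreover have "0 \<le> p * q * (u - \<alpha> * q - \<alpha>) + h u"
      using h0[of u] Q pq \<open>1 \<le> u\<close> by (intro add_nonneg_nonneg mult_nonneg_nonneg) auto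
    ultimately have "(1 - \<alpha>)\<^sup>2 * (p * q * (u - \<alpha> * q - \<alpha>) + h u) \<le> p * q * (u - \<alpha> * q - \<alpha>) + h u"
      by (rule mult_left_le_one_le[rotated 2]) simp
    also note *
    also have "(p * q + 1) * (u - \<alpha> * q - \<alpha>) \<le> (u - \<alpha> * p) * (u - \<alpha> * q) * (u - \<alpha> * q - \<alpha>)"
    proof (rule mult_right_mono)
      have "p * q + 1 \<le> (q + 2) * (p + 2)" using pq by (simp add: algebra_simps)
      also have "\<dots> \<le> (u - \<alpha> * p) * (u - \<alpha> * q)"
        by (intro mult_mono; use ap pq u_def in linarith)
      finally show "p * q + 1 \<le> (u - \<alpha> * p) * (u - \<alpha> * q)" .
    qed (use Q pq in auto)
    finally show ?thesis unfolding F_def by simp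
  qed
  have "\<alpha> * p \<le> p" "\<alpha> * (q + 1) \<le> q + 1" using \<alpha> pq by (auto intro: mult_left_le_one_le)
  then have "l \<le> u" unfolding l_def u_def using pq by linarith
  moreover have "continuous_on {l..u} F"
    unfolding F_def h_def using \<alpha> by (intro continuous_intros) (auto simp: l_def)
  ultimately obtain \<rho> where \<rho>: "l \<le> \<rho>" "F \<rho> = 0"
    using IVT'[of F l 0 u] neg posF by auto
  with neg have "l < \<rho>" by (cases "l = \<rho>") auto
  then show ?thesis using \<rho>(2) unfolding F_def h_def l_def by (intro exI[of _ \<rho>]) auto
qed

text \<open>
  The values \<open>1, b, y\<close> belong to the part containing the start of the ear, to that start, and to
  the other part. The values \<open>b', y'\<close> serve a start in the smaller part: two of the three
  conditions are solved with equality, and the one at the start is then strict.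
\<close>

lemma B1_parameters:
  fixes \<alpha> p q :: real
  assumes \<alpha>: "0 \<le> \<alpha>" "\<alpha> < 1" and pq: "1 \<le> q" "q \<le> p"
  shows "\<exists>\<rho> t b y. 1 < \<rho> \<and> t = (1 - \<alpha>) / (\<rho> - \<alpha>) \<and> 1 < b \<and> t < y \<and>
    \<rho> - \<alpha> * q = (1 - \<alpha>) * (q * y) \<and>
    (\<rho> - \<alpha> * q - \<alpha>) * b = (1 - \<alpha>) * (q * y + t ^ k) \<and>
    (\<rho> - \<alpha> * p) * y = (1 - \<alpha>) * (p - 1 + b) \<and>
    (q < p \<longrightarrow> (\<exists>b' y'. 1 \<le> b' \<and> t \<le> y' \<and>
      \<rho> - \<alpha> * p \<le> (1 - \<alpha>) * (p * y') \<and>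
      (\<rho> - \<alpha> * p - \<alpha>) * b' < (1 - \<alpha>) * (p * y' + t ^ k) \<and>
      (\<rho> - \<alpha> * q) * y' \<le> (1 - \<alpha>) * (q - 1 + b')))"
proof -
  obtain \<rho> where \<rho>: "\<rho> > 1" "\<alpha> * p < \<rho>" "\<alpha> * (q + 1) < \<rho>"
    and root: "(\<rho> - \<alpha> * p) * (\<rho> - \<alpha> * q) * (\<rho> - \<alpha> * q - \<alpha>) = (1 - \<alpha>)\<^sup>2 *
      (p * q * (\<rho> - \<alpha> * q - \<alpha>) + q * (\<alpha> + (1 - \<alpha>) * ((1 - \<alpha>) / (\<rho> - \<alpha>)) ^ k))"
    using B1_char_eq_root[OF assms, of k] by blast
  define t where "t = (1 - \<alpha>) / (\<rho> - \<alpha>)"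
  define \<beta> where "\<beta> = 1 - \<alpha>"
  define P where "P = \<rho> - \<alpha> * p"
  define Q where "Q = \<rho> - \<alpha> * q"
  define R where "R = Q - \<alpha>"
  \<comment> \<open>\<open>c\<close> is the excess in the condition at the start: its right side
    equals \<open>R + c\<close>, whence \<open>b = 1 + c / R\<close>.\<close>
  define c where "c = \<alpha> + \<beta> * t ^ k"
  have \<beta>: "\<beta> > 0" and P: "P > 0" and R: "R > 0"
    using \<alpha> \<rho> by (auto simp: \<beta>_def P_def R_def Q_def algebra_simps)
  have Q: "Q > 0" using R \<alpha> by (simp add: R_def)
  have t: "t > 0" using \<alpha> \<rho> by (simp add: t_def)
  have c: "c > 0" unfolding c_def using \<alpha> \<beta> t by (intro add_nonneg_pos) auto
  have root': "P * Q * R = \<beta>\<^sup>2 * (p * q * R + q * c)"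
    using root unfolding P_def Q_def R_def c_def \<beta>_def t_def by simp
  then have PQ: "P * Q = \<beta>\<^sup>2 * (p * q + q * c / R)" using R by (simp add: field_simps)
  define b where "b = 1 + c / R"
  define y where "y = Q / (\<beta> * q)"
  have eqS: "Q = \<beta> * (q * y)" using \<beta> pq by (simp add: y_def)
  have eqv: "R * b = \<beta> * (q * y + t ^ k)"
    unfolding distrib_left eqS[symmetric] using R by (simp add: b_def c_def R_def field_simps)
  have eqT: "P * y = \<beta> * (p - 1 + b)"
  proof -
    have "P * y = (P * Q) / (\<beta> * q)" by (simp add: y_def)
    also have "\<dots> = \<beta> * (p - 1 + b)" unfolding PQ using \<beta> pq R
      by (simp add: b_def field_simps power2_eq_square)
    finally show ?thesis .
  qed
  \<comment> \<open>The second estimate yields \<open>t < y\<close>, the first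
    \<open>t \<le> y'\<close>.\<close>
  have PR: "P * (\<rho> - \<alpha>) \<ge> \<beta>\<^sup>2 * p" "P \<le> \<rho> - \<alpha>"
  proof -
    have "Q \<le> \<rho> - \<alpha>" using \<alpha> pq mult_left_mono[of 1 q \<alpha>] by (simp add: Q_def)
    moreover have "p * 1 \<le> p * q" "q * c / R \<ge> 0" using pq c R by (auto intro!: mult_left_mono)
    ultimately have "\<beta>\<^sup>2 * p \<le> \<beta>\<^sup>2 * (p * q + q * c / R)" "P * Q \<le> P * (\<rho> - \<alpha>)"
      using P by (auto intro!: mult_left_mono)
    then show "P * (\<rho> - \<alpha>) \<ge> \<beta>\<^sup>2 * p" unfolding PQ[symmetric] by simp
    show "P \<le> \<rho> - \<alpha>" using \<alpha> pq mult_left_mono[of 1 p \<alpha>] by (simp add: P_def)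
  qed
  have b1: "1 < b" using c R by (simp add: b_def)
  have y1: "t < y"
  proof -
    have "\<beta> * 1 < \<beta> * (p - 1 + b)" using \<beta> b1 pq by (intro mult_strict_left_mono) auto
    also have "\<dots> = P * y" by (simp add: eqT)
    also have "\<dots> \<le> (\<rho> - \<alpha>) * y" using PR(2) Q \<beta> pq by (intro mult_right_mono) (auto simp: y_def)
    finally show ?thesis unfolding t_def \<beta>_def[symmetric] using \<alpha> \<rho> by (simp add: divide_less_eq mult.commute)
  qed
  \<comment> \<open>With the sizes exchanged, \<open>y'\<close> solves the condition on the part of
    the start, and \<open>PQ\<close> then determines \<open>b'\<close> from the condition on the
    other part.\<close>
  define b' where "b' = 1 + (q / p) * (c / R)"
  define y' where "y' = P / (\<beta> * p)"
  have eqS': "P = \<beta> * (p * y')" using \<beta> pq by (simp add: y'_def)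
  have eqT': "Q * y' = \<beta> * (q - 1 + b')"
  proof -
    have "Q * y' = (P * Q) / (\<beta> * p)" by (simp add: y'_def)
    also have "\<dots> = \<beta> * (q - 1 + b')" unfolding PQ using \<beta> pq R
      by (simp add: b'_def field_simps power2_eq_square)
    finally show ?thesis .
  qed
  have b1': "1 \<le> b'" using c R pq by (simp add: b'_def)
  have y1': "t \<le> y'"
  proof -
    have "\<beta> * (\<beta> * p) \<le> P * (\<rho> - \<alpha>)" using PR(1) by (simp add: power2_eq_square mult.assoc)
    then show ?thesis using \<beta> pq \<alpha> \<rho> unfolding t_def y'_def \<beta>_def[symmetric]
      by (simp add: divide_simps mult.commute)
  qed
  \<comment> \<open>By \<open>P - \<alpha> \<le> R\<close> and \<open>q / p < 1\<close>, the left
    side exceeds \<open>P - \<alpha>\<close> by less than \<open>c\<close>, while the right side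
    equals \<open>P - \<alpha> + c\<close>.\<close>
  have eqv': "(P - \<alpha>) * b' < \<beta> * (p * y' + t ^ k)" if "q < p"
  proof -
    have "(P - \<alpha>) * q \<le> R * q"
      using that \<alpha> pq mult_left_mono[of q p \<alpha>] by (intro mult_right_mono) (auto simp: P_def R_def Q_def)
    also have "\<dots> < R * p" using that R by simp
    finally have "(P - \<alpha>) * q / (R * p) < 1" using R pq by simp
    then have "(P - \<alpha>) * q / (R * p) * c < 1 * c" using c by (rule mult_strict_right_mono)
    then have "(P - \<alpha>) * b' < (P - \<alpha>) + c" by (simp add: b'_def distrib_left mult.assoc mult.commute[of p R])
    then show ?thesis unfolding distrib_left eqS'[symmetric] by (simp add: c_def)
  qed
  have "\<exists>b' y'. 1 \<le> b' \<and> t \<le> y' \<and> P \<le> \<beta> * (p * y') \<and>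
      (P - \<alpha>) * b' < \<beta> * (p * y' + t ^ k) \<and> Q * y' \<le> \<beta> * (q - 1 + b')" if "q < p"
    by (intro exI[of _ b'] exI[of _ y'] conjI b1' y1' eqv'[OF that] eq_refl[OF eqS'] eq_refl[OF eqT'])
  then show ?thesis
    using \<rho>(1) t_def b1 y1 eqS eqv eqT unfolding P_def Q_def R_def \<beta>_def by blast
qed

section \<open>Isomorphic digraphs\<close>

text \<open>Isomorphisms also carry a map of arcs; \<open>A_alpha_op\<close> sees only
  out-neighbourhoods, so a vertex bijection that preserves these is extracted.\<close>

lemma digraph_isoE:
  assumes "digraph_iso G H"
  obtains f where "bij_betw f (verts G) (verts H)"
    and "\<And>u. u \<in> verts G \<Longrightarrow> f ` (arcs_ends G `` {u}) = arcs_ends H `` {f u}"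
proof -
  from assms obtain hom where hom: "pre_digraph.digraph_isomorphism G hom" and H: "H = app_iso hom G"
    unfolding digraph_iso_def by blast
  let ?f = "iso_verts hom"
  have wf: "wf_digraph G" and inj: "inj_on ?f (verts G)"
    and ends: "\<And>e. e \<in> arcs G \<Longrightarrow> iso_tail hom (iso_arcs hom e) = ?f (tail G e) \<and>
      iso_head hom (iso_arcs hom e) = ?f (head G e)"
    using hom unfolding pre_digraph.digraph_isomorphism_def by auto
  have aeH: "arcs_ends H = (\<lambda>e. (?f (tail G e), ?f (head G e))) ` arcs G"
    unfolding H arcs_ends_conv by (auto simp: app_iso_def ends image_image)
  show ?thesis
  proof (rule that)
    show "bij_betw ?f (verts G) (verts H)" using inj by (simp add: bij_betw_def H verts_app_iso)
    fix u assume u: "u \<in> verts G"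
    \<comment> \<open>Injectivity on vertices: an arc whose image leaves \<open>?f u\<close> already
      leaves \<open>u\<close>, so the image has no further out-neighbours there.\<close>
    have "tail G e = u" if "e \<in> arcs G" "?f (tail G e) = ?f u" for e
      using inj_onD[OF inj that(2)] wf_digraph.tail_in_verts[OF wf that(1)] u by blast
    then show "?f ` (arcs_ends G `` {u}) = arcs_ends H `` {?f u}"
      unfolding aeH unfolding arcs_ends_conv by (fastforce simp: image_iff)
  qed
qed

text \<open>Without parallel arcs an arc is determined by its ends, so the vertex bijection induces
  the map of arcs. By \<open>wf\<close> every arc of \<open>H\<close> starts at some
  \<open>f u\<close> and is thereby covered by \<open>nb\<close>.\<close>

lemma digraph_isoI:
  assumes "digraph G" and bij: "bij_betw f (verts G) (pverts H)"
    and nb: "\<And>u. u \<in> verts G \<Longrightarrow> f ` (arcs_ends G `` {u}) = parcs H `` {f u}"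
    and wf: "fst ` parcs H \<subseteq> pverts H"
  shows "digraph_iso G (with_proj H)"
proof -
  interpret digraph G by fact
  define hom where "hom = \<lparr>iso_verts = f, iso_arcs = \<lambda>e. (f (tail G e), f (head G e)),
    iso_head = snd, iso_tail = fst\<rparr>"
  have inj: "inj_on f (verts G)" using bij by (simp add: bij_betw_def)
  have "digraph_isomorphism hom"
    unfolding digraph_isomorphism_def
  proof (intro conjI ballI)
    show "inj_on (iso_arcs hom) (arcs G)"
    proof (rule inj_onI)
      fix e e' assume e: "e \<in> arcs G" "e' \<in> arcs G" "iso_arcs hom e = iso_arcs hom e'"
      then have "tail G e = tail G e'" "head G e = head G e'"
        using inj by (auto simp: hom_def inj_on_def)
      then show "e = e'" using e no_multi_arcs by (simp add: arc_to_ends_def)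
    qed
  qed (use inj wf_digraph in \<open>auto simp: hom_def\<close>)
  moreover have "(\<lambda>e. (f (tail G e), f (head G e))) ` arcs G = parcs H"
  proof (intro equalityI subsetI)
    fix c assume "c \<in> (\<lambda>e. (f (tail G e), f (head G e))) ` arcs G"
    then obtain e where e: "e \<in> arcs G" "c = (f (tail G e), f (head G e))" by auto
    then have "f (head G e) \<in> f ` (arcs_ends G `` {tail G e})" by (auto simp: arcs_ends_conv)
    then show "c \<in> parcs H" using nb[of "tail G e"] e by simp
  next
    fix c assume c: "c \<in> parcs H"
    then have "fst c \<in> f ` verts G" using wf bij by (auto simp: bij_betw_def)
    then obtain u where u: "u \<in> verts G" "fst c = f u" by auto
    then have "snd c \<in> f ` (arcs_ends G `` {u})" using c nb[OF u(1)] by (cases c) auto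
    then obtain u' where "(u, u') \<in> arcs_ends G" "snd c = f u'" by auto
    then show "c \<in> (\<lambda>e. (f (tail G e), f (head G e))) ` arcs G"
      using u unfolding arcs_ends_conv by (cases c) (auto simp: image_iff)
  qed
  then have "with_proj H = app_iso hom G"
    using bij by (simp add: app_iso_def hom_def with_proj_def bij_betw_def)
  ultimately show ?thesis unfolding digraph_iso_def by blast
qed

text \<open>An eigenvector of \<open>H\<close> pulls back along the vertex bijection to one of
  \<open>G\<close>. Used in both directions, this identifies the two spectra.\<close>

lemma eigenvalue_A_alpha_iso:
  assumes G: "digraph G" "distinct vs" "set vs = verts G"
    and H: "digraph H" "distinct ws" "set ws = verts H" and iso: "digraph_iso G H"
    and ev: "eigenvalue (map_mat complex_of_real (A_alpha \<alpha> ws H)) k"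
  shows "eigenvalue (map_mat complex_of_real (A_alpha \<alpha> vs G)) k"
proof -
  obtain x where x: "\<exists>v\<in>verts H. x v \<noteq> 0" "\<And>v. v \<in> verts H \<Longrightarrow> A_alpha_op \<alpha> H x v = k * x v"
    using ev unfolding digraph.eigenvalue_A_alpha_iff_op[OF H] by blast
  obtain f where f: "bij_betw f (verts G) (verts H)"
    "\<And>u. u \<in> verts G \<Longrightarrow> f ` (arcs_ends G `` {u}) = arcs_ends H `` {f u}"
    using digraph_isoE[OF iso] by blast
  have "A_alpha_op \<alpha> G (x \<circ> f) u = A_alpha_op \<alpha> H x (f u)" if u: "u \<in> verts G" for u
  proof -
    have "inj_on f (arcs_ends G `` {u})"
      by (rule inj_on_subset[OF bij_betw_imp_inj_on[OF f(1)] digraph.out_neighbours_subset[OF G(1)]])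
    then show ?thesis
      unfolding A_alpha_op_def f(2)[OF u, symmetric] by (simp add: sum.reindex card_image)
  qed
  moreover have "f u \<in> verts H" if "u \<in> verts G" for u using f(1) that by (auto simp: bij_betw_def)
  moreover have "\<exists>u\<in>verts G. x (f u) \<noteq> 0" using x(1) unfolding bij_betw_imp_surj_on[OF f(1), symmetric] by blast
  ultimately show ?thesis
    unfolding digraph.eigenvalue_A_alpha_iff_op[OF G] using x(2) by (intro exI[of _ "x \<circ> f"]) auto
qed

lemma lambda_alpha_iso:
  assumes G: "digraph G" and H: "digraph H" and iso: "digraph_iso G H"
  shows "lambda_alpha \<alpha> G = lambda_alpha \<alpha> H"
proof -
  interpret G: digraph G by fact
  interpret H: digraph H by fact
  obtain vs where vs: "distinct vs" "set vs = verts G"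
    using finite_distinct_list[OF G.finite_verts] by auto
  obtain ws where ws: "distinct ws" "set ws = verts H"
    using finite_distinct_list[OF H.finite_verts] by auto
  have "digraph_iso H G" using digraph_iso_swap[OF G.wf_digraph iso] .
  from eigenvalue_A_alpha_iso[OF H ws G vs this] eigenvalue_A_alpha_iso[OF G vs H ws iso]
  show ?thesis unfolding lambda_alpha_eq[OF vs] lambda_alpha_eq[OF ws]
      spectral_radius_def spectrum_def by (intro arg_cong[of _ _ Max] arg_cong[of _ _ "(`) norm"]) blast
qed

section \<open>Bipartite digraphs extending a complete bipartite one\<close>

text \<open>\<open>S\<close> is the part containing the start \<open>v\<close> of the exit arc. It
  may be the larger or the smaller part, so the locale serves both cases of the theorem.\<close>

locale extended_biclique = digraph G for G :: "('a,'b) pre_digraph" (structure) +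
  fixes S T X Y :: "'a set" and v w :: 'a
  assumes strong: "strongly_connected G"
    and sides: "verts G = X \<union> Y" "X \<inter> Y = {}"
    and bipartite: "u \<rightarrow>\<^bsub>G\<^esub> u' \<Longrightarrow> u \<in> X \<and> u' \<in> Y \<or> u \<in> Y \<and> u' \<in> X"
    and parts: "S \<subseteq> X" "T \<subseteq> Y"
    and biclique: "S \<times> T \<union> T \<times> S \<subseteq> arcs_ends G"
    and odd_rest: "odd (card (verts G - S - T))"
    and exit: "v \<in> S" "w \<notin> T" "v \<rightarrow>\<^bsub>G\<^esub> w"
begin

section \<open>Distances to the part \<open>S\<close>\<close>

definition rest :: "'a set" where "rest = verts G - S - T"

text \<open>The distance to the nearest vertex of \<open>S\<close>, with \<open>v\<close> included;
  strong connectivity ensures that it is attained at every vertex.\<close>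

definition depth :: "'a \<Rightarrow> nat" where
  "depth u = (LEAST m. \<exists>s\<in>S. (u, s) \<in> arcs_ends G ^^ m)"

lemma S_T_rest: "S \<subseteq> verts G" "T \<subseteq> verts G" "rest \<subseteq> verts G" "S \<inter> T = {}" "S \<inter> rest = {}"
  "T \<inter> rest = {}" "verts G = S \<union> T \<union> rest"
  using sides parts by (auto simp: rest_def)

lemma finite_S_T_rest [simp]: "finite S" "finite T" "finite rest"
  by (rule finite_subset[OF S_T_rest(1)], simp, rule finite_subset[OF S_T_rest(2)], simp,
      rule finite_subset[OF S_T_rest(3)], simp)

lemma w_rest: "w \<in> rest"
  using exit bipartite[OF exit(3)] sides parts adj_in_verts[OF exit(3)] by (auto simp: rest_def)

lemma depth_attained:
  assumes "u \<in> verts G"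
  shows "\<exists>s\<in>S. (u, s) \<in> arcs_ends G ^^ depth u"
proof -
  have "u \<rightarrow>\<^sup>*\<^bsub>G\<^esub> v" using strong assms exit(1) S_T_rest(1) unfolding strongly_connected_def by blast
  from rtrancl_imp_relpow[OF reachable_rtranclI[OF this]]
  obtain m where "(u, v) \<in> arcs_ends G ^^ m" by blast
  then have "\<exists>m. \<exists>s\<in>S. (u, s) \<in> arcs_ends G ^^ m" using exit(1) by blast
  then show ?thesis unfolding depth_def by (rule LeastI_ex)
qed

lemma depth_le: "s \<in> S \<Longrightarrow> (u, s) \<in> arcs_ends G ^^ m \<Longrightarrow> depth u \<le> m"
  unfolding depth_def by (rule Least_le) blast

lemma depth_eq_0_iff: "u \<in> verts G \<Longrightarrow> depth u = 0 \<longleftrightarrow> u \<in> S"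
  using depth_attained[of u] depth_le[of u u 0] by auto

lemma depth_step:
  assumes "u \<in> verts G" "depth u = Suc m"
  obtains u' where "u \<rightarrow>\<^bsub>G\<^esub> u'" "u' \<in> verts G" "depth u' = m"
proof -
  obtain s where s: "s \<in> S" "(u, s) \<in> arcs_ends G ^^ Suc m" using depth_attained[OF assms(1)] assms(2) by auto
  then obtain u' where u': "(u, u') \<in> arcs_ends G" "(u', s) \<in> arcs_ends G ^^ m"
    using relpow_Suc_D2 by metis
  have u'v: "u' \<in> verts G" using adj_in_verts[OF u'(1)] by simp
  obtain s' where s': "s' \<in> S" "(u', s') \<in> arcs_ends G ^^ depth u'" using depth_attained[OF u'v] by auto
  have "(u, s') \<in> arcs_ends G ^^ Suc (depth u')" using u'(1) s'(2) by (rule relpow_Suc_I2)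
  then have "Suc m \<le> Suc (depth u')" using depth_le[OF s'(1)] assms(2) by metis
  moreover have "depth u' \<le> m" using depth_le[OF s(1) u'(2)] .
  ultimately show ?thesis using that u' u'v by simp
qed

text \<open>\<open>S\<close> lies in \<open>X\<close>, and every arc changes sides.\<close>

lemma even_depth_iff: "u \<in> verts G \<Longrightarrow> even (depth u) \<longleftrightarrow> u \<in> X"
proof (induction "depth u" arbitrary: u)
  case 0
  then show ?case using depth_eq_0_iff[of u] parts by auto
next
  case (Suc m)
  obtain u' where u': "u \<rightarrow>\<^bsub>G\<^esub> u'" "u' \<in> verts G" "depth u' = m"
    using depth_step[OF Suc.prems Suc.hyps(2)[symmetric]] by blast
  have "even m \<longleftrightarrow> u' \<in> X" using Suc.hyps(1)[of u'] u' by simp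
  then show ?case using bipartite[OF u'(1)] sides(2) Suc.hyps(2)[symmetric] by auto
qed

lemma depth_T:
  assumes "u \<in> T"
  shows "depth u = 1"
proof -
  have "(u, v) \<in> arcs_ends G ^^ 1" using biclique assms exit(1) by auto
  then have "depth u \<le> 1" using depth_le exit(1) by blast
  moreover have "depth u \<noteq> 0" using depth_eq_0_iff[of u] assms S_T_rest by auto
  ultimately show ?thesis by simp
qed

lemma depth_levels:
  assumes "u \<in> verts G" "j \<le> depth u"
  shows "\<exists>u'\<in>verts G. depth u' = j"
  using assms(2)
proof (induction rule: inc_induct)
  case base
  then show ?case using assms(1) by blast
next
  case (step m)
  then show ?case using depth_step by metis
qed

text \<open>
  Levels \<open>2, \<dots>, depth w\<close> lie outside the biclique, so \<open>depth w \<le> card rest + 1\<close>; parity excludes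
  equality.
\<close>

lemma depth_w_le: "depth w \<le> card rest"
proof -
  have wv: "w \<in> verts G" using w_rest S_T_rest by auto
  have "{2..depth w} \<subseteq> depth ` rest"
  proof
    fix j assume j: "j \<in> {2..depth w}"
    then obtain u where u: "u \<in> verts G" "depth u = j" using depth_levels[OF wv] by auto
    then have "u \<notin> S" "u \<notin> T" using j depth_eq_0_iff[of u] depth_T[of u] by auto
    then show "j \<in> depth ` rest" using u S_T_rest(7) by auto
  qed
  then have "card {2..depth w} \<le> card rest" by (intro surj_card_le) auto
  then have "depth w \<le> Suc (card rest)" by simp
  \<comment> \<open>\<open>w\<close> lies in \<open>Y\<close>, being an out-neighbour of
    \<open>v\<close> in \<open>X\<close>.\<close>
  moreover have "odd (depth w)"
    using even_depth_iff[OF wv] bipartite[OF exit(3)] exit(1) parts sides(2) by auto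
  moreover have "odd (card rest)" using odd_rest by (simp add: rest_def)
  ultimately show ?thesis by (cases "depth w = Suc (card rest)") auto
qed

text \<open>In \<open>B1\<close> with \<open>v = 1\<close> this is the eigenvector used in
  \<open>lambda_alpha_B1\<close>. Only \<open>v\<close> and \<open>T\<close> deviate from
  \<open>t ^ depth u\<close>.\<close>

definition weight :: "real \<Rightarrow> real \<Rightarrow> real \<Rightarrow> 'a \<Rightarrow> real" where
  "weight t b y u = (if u = v then b else if u \<in> S then 1 else if u \<in> T then y else t ^ depth u)"

text \<open>Depth is 0 on \<open>S\<close> and 1 on \<open>T\<close>, so \<open>1 \<le> b\<close>
  and \<open>t \<le> y\<close> only raise the weight there. Hence a shortest path from
  \<open>rest\<close> may enter the biclique anywhere.\<close>

lemma weight_ge_power_depth: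
  assumes "u \<in> verts G" "1 \<le> b" "t \<le> y"
  shows "t ^ depth u \<le> weight t b y u"
  using assms depth_eq_0_iff[OF assms(1)] depth_T[of u] exit(1) by (auto simp: weight_def)

lemma weight_pos: "0 < b \<Longrightarrow> 0 < y \<Longrightarrow> 0 < t \<Longrightarrow> 0 < weight t b y u"
  by (simp add: weight_def)

end

section \<open>The weight as a subsolution\<close>

context extended_biclique
begin

text \<open>The three bounds are the subsolution conditions on \<open>S - {v}\<close>, at
  \<open>v\<close> and on \<open>T\<close>, with \<open>w\<close> counted as
  \<open>t ^ card rest\<close>. As inequalities they admit both pairs of parameters,
  \<open>b, y\<close> and \<open>b', y'\<close>.\<close>

context
  fixes \<alpha> \<rho> t b y :: real
  assumes \<alpha>: "0 \<le> \<alpha>" "\<alpha> < 1" and \<rho>: "1 < \<rho>" and t: "t = (1 - \<alpha>) / (\<rho> - \<alpha>)"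
    and b: "1 \<le> b" and y: "t \<le> y"
    and boundS: "\<rho> - \<alpha> * card T \<le> (1 - \<alpha>) * (card T * y)"
    and boundv: "(\<rho> - \<alpha> * card T - \<alpha>) * b \<le> (1 - \<alpha>) * (card T * y + t ^ card rest)"
    and boundT: "(\<rho> - \<alpha> * card S) * y \<le> (1 - \<alpha>) * (real (card S) - 1 + b)"
begin

abbreviation "z \<equiv> weight t b y"

lemma t_bounds: "0 < t" "t < 1"
  using \<alpha> \<rho> by (auto simp: t)

text \<open>This is the eigenvalue equation at a vertex whose single out-arc leads one step closer
  to \<open>S\<close>.\<close>

lemma t_recursion: "\<alpha> * t ^ Suc m + (1 - \<alpha>) * t ^ m = \<rho> * t ^ Suc m"
proof -
  have "\<alpha> * t + (1 - \<alpha>) = \<rho> * t" using \<alpha> \<rho> by (simp add: t field_simps)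
  then have "(\<alpha> * t + (1 - \<alpha>)) * t ^ m = \<rho> * t * t ^ m" by simp
  then show ?thesis by (simp add: algebra_simps)
qed

lemma z_pos: "0 < z u"
  using weight_pos[of b y t u] t_bounds b y by simp

text \<open>Every out-arc contributes a positive amount. Known arcs thus give a lower bound,
  attained only if there are no others; the latter determines the arcs of an extremal
  digraph.\<close>

lemma partial_sum_le:
  assumes "N \<subseteq> arcs_ends G `` {u}"
  shows "(\<Sum>u'\<in>N. \<alpha> * z u + (1 - \<alpha>) * z u') \<le> A_alpha_op \<alpha> G z u"
    and "A_alpha_op \<alpha> G z u \<le> (\<Sum>u'\<in>N. \<alpha> * z u + (1 - \<alpha>) * z u') \<Longrightarrow> arcs_ends G `` {u} = N"
proof -
  let ?g = "\<lambda>u'. \<alpha> * z u + (1 - \<alpha>) * z u'"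
  have g: "?g u' > 0" for u'
    using z_pos[of u] z_pos[of u'] \<alpha> by (intro add_nonneg_pos mult_nonneg_nonneg mult_pos_pos) auto
  have split: "A_alpha_op \<alpha> G z u = sum ?g (arcs_ends G `` {u} - N) + sum ?g N"
    unfolding A_alpha_op_def using sum.subset_diff[OF assms, of ?g] by simp
  have "sum ?g (arcs_ends G `` {u} - N) \<ge> 0" using g by (intro sum_nonneg) (simp add: less_imp_le)
  then show "sum ?g N \<le> A_alpha_op \<alpha> G z u" using split by simp
  assume "A_alpha_op \<alpha> G z u \<le> sum ?g N"
  then have "sum ?g (arcs_ends G `` {u} - N) \<le> 0" using split by simp
  then have "arcs_ends G `` {u} - N = {}"
    using sum_pos[of "arcs_ends G `` {u} - N" ?g] g by fastforce
  then show "arcs_ends G `` {u} = N" using assms by auto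
qed

lemma z_T: "u \<in> T \<Longrightarrow> z u = y"
  using S_T_rest exit(1) by (auto simp: weight_def)

lemma z_rest: "u \<in> rest \<Longrightarrow> z u = t ^ depth u"
  using S_T_rest exit(1) by (auto simp: weight_def)

lemma sum_at_v:
  "(\<Sum>u'\<in>insert w T. \<alpha> * z v + (1 - \<alpha>) * z u')
    = (\<alpha> * card T + \<alpha>) * b + (1 - \<alpha>) * (card T * y + t ^ depth w)"
proof -
  have "w \<notin> T" by (rule exit(2))
  moreover have "(\<Sum>u'\<in>T. \<alpha> * z v + (1 - \<alpha>) * z u') = (\<Sum>u'\<in>T. \<alpha> * b + (1 - \<alpha>) * y)"
    by (rule sum.cong) (simp_all add: z_T weight_def[of _ _ _ v])
  ultimately show ?thesis using z_rest[OF w_rest] weight_def[of t b y v]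
    by (simp add: algebra_simps)
qed

lemma sum_at_S:
  assumes "u \<in> S" "u \<noteq> v"
  shows "(\<Sum>u'\<in>T. \<alpha> * z u + (1 - \<alpha>) * z u') = \<alpha> * card T + (1 - \<alpha>) * (card T * y)"
proof -
  have "(\<Sum>u'\<in>T. \<alpha> * z u + (1 - \<alpha>) * z u') = (\<Sum>u'\<in>T. \<alpha> + (1 - \<alpha>) * y)"
    using assms by (intro sum.cong) (simp_all add: z_T weight_def[of _ _ _ u])
  then show ?thesis by (simp add: algebra_simps)
qed

lemma sum_at_T:
  assumes "u \<in> T"
  shows "(\<Sum>u'\<in>S. \<alpha> * z u + (1 - \<alpha>) * z u') = \<alpha> * card S * y + (1 - \<alpha>) * (real (card S) - 1 + b)"
proof -
  have "(\<Sum>u'\<in>S. \<alpha> * y + (1 - \<alpha>) * z u')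
      = (\<alpha> * y + (1 - \<alpha>) * b) + (\<Sum>u'\<in>S - {v}. \<alpha> * y + (1 - \<alpha>) * z u')"
    using sum.remove[OF finite_S_T_rest(1) exit(1), of "\<lambda>u'. \<alpha> * y + (1 - \<alpha>) * z u'"]
    by (simp only: weight_def[of _ _ _ v] refl if_True)
  also have "(\<Sum>u'\<in>S - {v}. \<alpha> * y + (1 - \<alpha>) * z u') = (\<Sum>u'\<in>S - {v}. \<alpha> * y + (1 - \<alpha>))"
    by (rule sum.cong) (simp_all add: weight_def)
  also have "\<dots> = (real (card S) - 1) * (\<alpha> * y + (1 - \<alpha>))"
  proof -
    have "card S > 0" using exit(1) card_gt_0_iff[of S] by auto
    then show ?thesis using exit(1) by (simp add: of_nat_diff)
  qed
  finally show ?thesis using z_T[OF assms] by (simp add: algebra_simps)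
qed

lemma neighbours_v: "insert w T \<subseteq> arcs_ends G `` {v}"
  using exit biclique by auto

lemma neighbours_S: "u \<in> S \<Longrightarrow> T \<subseteq> arcs_ends G `` {u}"
  using biclique by auto

lemma neighbours_T: "u \<in> T \<Longrightarrow> S \<subseteq> arcs_ends G `` {u}"
  using biclique by auto

text \<open>As \<open>t < 1\<close>, the bound \<open>depth_w_le\<close> gives \<open>w\<close> at
  least the weight of the first vertex of a path through all of \<open>rest\<close>.\<close>

lemma power_depth_w: "(1 - \<alpha>) * t ^ card rest \<le> (1 - \<alpha>) * t ^ depth w"
  using depth_w_le t_bounds \<alpha> by (intro mult_left_mono power_decreasing) auto

lemma le_sum_at_v: "\<rho> * z v \<le> (\<Sum>u'\<in>insert w T. \<alpha> * z v + (1 - \<alpha>) * z u')"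
  unfolding sum_at_v using boundv power_depth_w by (simp add: weight_def algebra_simps)

text \<open>By \<open>t_recursion\<close> equality holds if \<open>z u'\<close> is exactly
  \<open>t ^ depth u'\<close>, and a raised weight of \<open>u'\<close> only helps; conversely,
  equality rules out a raise.\<close>

lemma le_sum_at_rest:
  assumes "u' \<in> verts G" "depth u = Suc (depth u')" "u \<in> rest"
  shows "\<rho> * z u \<le> \<alpha> * z u + (1 - \<alpha>) * z u'"
    and "\<alpha> * z u + (1 - \<alpha>) * z u' \<le> \<rho> * z u \<Longrightarrow> z u' = t ^ depth u'"
proof -
  have ge: "t ^ depth u' \<le> z u'" using weight_ge_power_depth[OF assms(1) b y] .
  have rec: "\<rho> * z u = \<alpha> * z u + (1 - \<alpha>) * t ^ depth u'"
    using t_recursion[of "depth u'"] z_rest[OF assms(3)] assms(2) by simp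
  show "\<rho> * z u \<le> \<alpha> * z u + (1 - \<alpha>) * z u'"
    unfolding rec using ge \<alpha> by (intro add_left_mono mult_left_mono) auto
  assume "\<alpha> * z u + (1 - \<alpha>) * z u' \<le> \<rho> * z u"
  then have "(1 - \<alpha>) * z u' \<le> (1 - \<alpha>) * t ^ depth u'" unfolding rec by simp
  then show "z u' = t ^ depth u'" using \<alpha> ge by simp
qed

lemma depth_rest:
  assumes "u \<in> rest"
  obtains u' where "u' \<in> verts G" "u \<rightarrow>\<^bsub>G\<^esub> u'" "depth u = Suc (depth u')"
proof -
  have u: "u \<in> verts G" "u \<notin> S" using assms S_T_rest by auto
  then obtain m where "depth u = Suc m" using depth_eq_0_iff[of u] by (cases "depth u") auto
  then show ?thesis using depth_step[OF u(1)] that by metis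
qed

text \<open>Only guaranteed arcs are counted: those of the biclique, the exit arc at
  \<open>v\<close>, and one step of a shortest path at each vertex of \<open>rest\<close>.\<close>

lemma subsolution:
  assumes "u \<in> verts G"
  shows "\<rho> * z u \<le> A_alpha_op \<alpha> G z u"
proof -
  consider "u = v" | "u \<in> S" "u \<noteq> v" | "u \<in> T" | "u \<in> rest" using assms S_T_rest(7) by blast
  then show ?thesis
  proof cases
    case 1
    then show ?thesis using le_sum_at_v partial_sum_le(1)[OF neighbours_v] by (auto intro: order_trans)
  next
    case 2
    have "\<rho> * z u \<le> (\<Sum>u'\<in>T. \<alpha> * z u + (1 - \<alpha>) * z u')"
      unfolding sum_at_S[OF 2] using boundS 2 by (simp add: weight_def)
    then show ?thesis using partial_sum_le(1)[OF neighbours_S[OF 2(1)]] by (rule order_trans)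
  next
    case 3
    have "\<rho> * z u \<le> (\<Sum>u'\<in>S. \<alpha> * z u + (1 - \<alpha>) * z u')"
      unfolding sum_at_T[OF 3] using boundT z_T[OF 3] by (simp add: algebra_simps)
    then show ?thesis using partial_sum_le(1)[OF neighbours_T[OF 3]] by (rule order_trans)
  next
    case 4
    then obtain u' where u': "u' \<in> verts G" "u \<rightarrow>\<^bsub>G\<^esub> u'" "depth u = Suc (depth u')"
      using depth_rest by blast
    have "\<rho> * z u \<le> (\<Sum>u'\<in>{u'}. \<alpha> * z u + (1 - \<alpha>) * z u')"
      using le_sum_at_rest(1)[OF u'(1,3) 4] by simp
    also have "\<dots> \<le> A_alpha_op \<alpha> G z u" using u' by (intro partial_sum_le(1)) auto
    finally show ?thesis .
  qed
qed

lemma verts_nonempty: "verts G \<noteq> {}"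
  using w_rest S_T_rest by auto

lemma lambda_alpha_ge: "\<rho> \<le> lambda_alpha \<alpha> G"
  using lambda_alpha_geI[OF \<alpha> verts_nonempty z_pos subsolution] .

lemma lambda_alpha_gt:
  assumes "(\<rho> - \<alpha> * card T - \<alpha>) * b < (1 - \<alpha>) * (card T * y + t ^ card rest)"
  shows "\<rho> < lambda_alpha \<alpha> G"
proof (rule lambda_alpha_gtI[OF \<alpha> strong z_pos subsolution])
  show "v \<in> verts G" using exit(1) S_T_rest by auto
  have "\<rho> * z v < (\<Sum>u'\<in>insert w T. \<alpha> * z v + (1 - \<alpha>) * z u')"
    unfolding sum_at_v using assms power_depth_w by (simp add: weight_def algebra_simps)
  then show "\<rho> * z v < A_alpha_op \<alpha> G z v"
    using partial_sum_le(1)[OF neighbours_v] by linarith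
qed

section \<open>The equality case\<close>

context
  assumes extremal: "lambda_alpha \<alpha> G = \<rho>" and b_strict: "1 < b" and y_strict: "t < y"
begin

text \<open>By \<open>lambda_alpha_gtI\<close>, a strict inequality at a single vertex would push
  \<open>lambda_alpha \<alpha> G\<close> above \<open>\<rho>\<close>.\<close>

lemma eigen: "u \<in> verts G \<Longrightarrow> A_alpha_op \<alpha> G z u = \<rho> * z u"
  using lambda_alpha_gtI[OF \<alpha> strong z_pos subsolution, of u] subsolution[of u] extremal by fastforce

text \<open>Both estimates used at \<open>v\<close> are tight: the counted arcs are all there are,
  and \<open>t ^ depth w\<close> equals its lower bound, which fixes the exponent as
  \<open>0 < t < 1\<close>.\<close>

lemma extremal_at_v: "arcs_ends G `` {v} = insert w T" "depth w = card rest"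
proof -
  have v: "v \<in> verts G" using exit(1) S_T_rest by auto
  show "arcs_ends G `` {v} = insert w T"
    using partial_sum_le(2)[OF neighbours_v] eigen[OF v] le_sum_at_v by simp
  have "(\<Sum>u'\<in>insert w T. \<alpha> * z v + (1 - \<alpha>) * z u') \<le> \<rho> * b"
    using partial_sum_le(1)[OF neighbours_v] eigen[OF v] by (simp add: weight_def[of _ _ _ v])
  then have "(1 - \<alpha>) * t ^ depth w \<le> (1 - \<alpha>) * t ^ card rest"
    unfolding sum_at_v using boundv by (simp add: algebra_simps)
  then have "t ^ depth w \<le> t ^ card rest" using \<alpha> by simp
  then have "card rest \<le> depth w" using t_bounds by (simp add: power_decreasing_iff)
  then show "depth w = card rest" using depth_w_le by simp
qed

lemma extremal_at_S:
  assumes "u \<in> S" "u \<noteq> v"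
  shows "arcs_ends G `` {u} = T"
proof -
  have u: "u \<in> verts G" using assms S_T_rest by auto
  have "\<rho> * z u \<le> (\<Sum>u'\<in>T. \<alpha> * z u + (1 - \<alpha>) * z u')"
    unfolding sum_at_S[OF assms] using boundS assms by (simp add: weight_def)
  then show ?thesis using partial_sum_le(2)[OF neighbours_S[OF assms(1)]] eigen[OF u] by simp
qed

lemma extremal_at_T:
  assumes "u \<in> T"
  shows "arcs_ends G `` {u} = S"
proof -
  have u: "u \<in> verts G" using assms S_T_rest by auto
  have "\<rho> * z u \<le> (\<Sum>u'\<in>S. \<alpha> * z u + (1 - \<alpha>) * z u')"
    unfolding sum_at_T[OF assms] using boundT z_T[OF assms] by (simp add: algebra_simps)
  then show ?thesis using partial_sum_le(2)[OF neighbours_T[OF assms]] eigen[OF u] by simp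
qed

text \<open>The weight of the only out-neighbour must be the plain power of \<open>t\<close>;
  \<open>t < y\<close> excludes \<open>T\<close>, and \<open>1 < b\<close> excludes a return to the
  start \<open>v\<close>.\<close>

lemma extremal_at_rest:
  assumes "u \<in> rest"
  obtains u' where "arcs_ends G `` {u} = {u'}" "depth u = Suc (depth u')" "u' \<in> S \<union> rest" "u' \<noteq> v"
proof -
  have u: "u \<in> verts G" using assms S_T_rest by auto
  obtain u' where u': "u' \<in> verts G" "u \<rightarrow>\<^bsub>G\<^esub> u'" "depth u = Suc (depth u')"
    using depth_rest[OF assms] by blast
  have sub: "{u'} \<subseteq> arcs_ends G `` {u}" using u' by auto
  have N: "arcs_ends G `` {u} = {u'}"
    using partial_sum_le(2)[OF sub] eigen[OF u] le_sum_at_rest(1)[OF u'(1,3) assms] by simp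
  have zu': "z u' = t ^ depth u'"
    using le_sum_at_rest(2)[OF u'(1,3) assms] partial_sum_le(1)[OF sub] eigen[OF u] by simp
  have "u' \<notin> T" using zu' z_T[of u'] depth_T[of u'] y_strict by auto
  moreover have "u' \<noteq> v"
    using zu' b_strict depth_eq_0_iff[OF u'(1)] exit(1) by (auto simp: weight_def)
  ultimately show ?thesis using that[OF N u'(3)] u'(1) S_T_rest(7) by blast
qed

text \<open>The sole out-arcs lead from \<open>w\<close>, at depth \<open>card rest\<close>, through
  all depths down to 1 inside \<open>rest\<close>. Attaining \<open>card rest\<close> values leaves
  one vertex for each, so \<open>rest\<close> forms a single path.\<close>

lemma bij_betw_depth: "bij_betw depth rest {1..card rest}"
proof -
  have "{1..card rest} \<subseteq> depth ` rest"
  proof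
    fix j assume "j \<in> {1..card rest}"
    then have "1 \<le> j" "j \<le> card rest" by auto
    from this(2,1) show "j \<in> depth ` rest"
    proof (induction rule: inc_induct)
      case base
      then show ?case using w_rest extremal_at_v(2) by (metis imageI)
    next
      case (step m)
      then obtain u where u: "u \<in> rest" "depth u = Suc m" by auto
      obtain u' where u': "depth u = Suc (depth u')" "u' \<in> S \<union> rest"
        using extremal_at_rest[OF u(1)] by metis
      then have "u' \<notin> S" using depth_eq_0_iff[of u'] u(2) step.prems S_T_rest(1) by auto
      then show ?case using u u' by auto
    qed
  qed
  then have "depth ` rest = {1..card rest}"
    using card_seteq[of "depth ` rest" "{1..card rest}"] card_image_le[of rest depth] by simp
  moreover have "inj_on depth rest"
    by (rule eq_card_imp_inj_on) (simp_all add: calculation)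
  ultimately show ?thesis by (simp add: bij_betw_def)
qed

text \<open>All out-neighbourhoods are now known. The numbering sends \<open>v\<close> to 1, the
  endpoint \<open>u0\<close> of the path to \<open>p\<close>, and a path vertex \<open>u\<close> to
  \<open>n + 1 - depth u\<close>; the remaining vertices are numbered arbitrarily within their
  parts.\<close>

lemma extremal_iso:
  assumes cardS: "2 \<le> card S" and cardT: "1 \<le> card T"
  shows "digraph_iso G (with_proj (B1 (card S + card T + card rest) (card S) (card T)))"
proof -
  define p q k where "p = card S" and "q = card T" and "k = card rest"
  define n where "n = p + q + k"
  have k: "0 < k" using w_rest card_gt_0_iff[of rest] unfolding k_def by auto
  note dbij = bij_betw_depth[folded k_def]
  \<comment> \<open>\<open>u1\<close> is the last vertex of the path in \<open>rest\<close>, and its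
    out-neighbour \<open>u0\<close> is the endpoint in \<open>S\<close>.\<close>
  obtain u1 where u1: "u1 \<in> rest" "depth u1 = 1"
  proof -
    have "1 \<in> depth ` rest" using bij_betw_imp_surj_on[OF dbij] k by simp
    then show ?thesis using that by auto
  qed
  obtain u0 where u0: "arcs_ends G `` {u1} = {u0}" "depth u1 = Suc (depth u0)" "u0 \<in> S \<union> rest" "u0 \<noteq> v"
    using extremal_at_rest[OF u1(1)] by blast
  have "u0 \<in> verts G" using u0(3) S_T_rest by blast
  then have u0S: "u0 \<in> S" using u0(2) u1(2) depth_eq_0_iff[of u0] by simp
  have "card (S - {v, u0}) = card {2..p - 1}"
    using exit(1) u0S u0(4) by (simp add: card_Diff_subset p_def)
  then obtain g where g: "bij_betw g (S - {v, u0}) {2..p - 1}"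
    using finite_same_card_bij[OF finite_Diff[OF finite_S_T_rest(1)] finite_atLeastAtMost] by blast
  have "card T = card {p+1..p+q}" by (simp add: q_def)
  then obtain h where h: "bij_betw h T {p+1..p+q}"
    using finite_same_card_bij[OF finite_S_T_rest(2) finite_atLeastAtMost] by blast
  define f where "f u = (if u = v then 1 else if u = u0 then p else if u \<in> S then g u
    else if u \<in> T then h u else n + 1 - depth u)" for u
  have p2: "2 \<le> p" and q1: "1 \<le> q" using assms by (auto simp: p_def q_def)
  have bS: "bij_betw f S {1..p}"
  proof -
    have "bij_betw f (S - {v, u0}) {2..p - 1}"
      using g by (rule bij_betw_cong[THEN iffD1, rotated]) (auto simp: f_def)
    moreover have "bij_betw f {v, u0} {1, p}"
      using u0(4) p2 by (auto simp: f_def bij_betw_def)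
    moreover have "{2..p - 1} \<inter> {1, p} = {}" using p2 by auto
    ultimately have "bij_betw f ((S - {v, u0}) \<union> {v, u0}) ({2..p - 1} \<union> {1, p})"
      by (rule bij_betw_combine)
    moreover have "(S - {v, u0}) \<union> {v, u0} = S" using u0S exit(1) by auto
    moreover have "{2..p - 1} \<union> {1, p} = {1..p}" using p2 by auto
    ultimately show ?thesis by simp
  qed
  have bT: "bij_betw f T {p+1..p+q}"
    using h by (rule bij_betw_cong[THEN iffD1, rotated]) (use S_T_rest exit(1) u0S in \<open>auto simp: f_def\<close>)
  have frest: "f u = n + 1 - depth u" if "u \<in> rest" for u
    using that S_T_rest exit(1) u0S by (auto simp: f_def)
  have bR: "bij_betw f rest {p+q+1..n}"
  proof -
    have "bij_betw (\<lambda>i. n + 1 - i) {1..k} {p+q+1..n}"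
      by (rule bij_betw_byWitness[where f' = "\<lambda>i. n + 1 - i"]) (auto simp: n_def)
    from bij_betw_trans[OF dbij this] show ?thesis
      by (rule bij_betw_cong[THEN iffD1, rotated]) (simp add: frest)
  qed
  have pqn: "p + q < n" using k by (simp add: n_def)
  have bij: "bij_betw f (verts G) {1..n}"
  proof -
    have "bij_betw f (S \<union> T) ({1..p} \<union> {p+1..p+q})"
      using bS bT by (rule bij_betw_combine) auto
    then have "bij_betw f (S \<union> T \<union> rest) ({1..p} \<union> {p+1..p+q} \<union> {p+q+1..n})"
      using bR by (rule bij_betw_combine) auto
    moreover have "{1..p} \<union> {p+1..p+q} \<union> {p+q+1..n} = {1..n}" using pqn by auto
    ultimately show ?thesis using S_T_rest(7) by simp
  qed
  note NB = out_neighbours_B1[OF pqn p2 q1, unfolded with_proj_simps]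
  \<comment> \<open>Depth \<open>k\<close> becomes the number \<open>n + 1 - k\<close>, the
    out-neighbour of 1 outside the biclique.\<close>
  have fw: "f w = p + q + 1" using frest[OF w_rest] extremal_at_v(2) by (simp add: n_def k_def)
  have imS: "f ` S = {1..p}" and imT: "f ` T = {p+1..p+q}"
    using bS bT by (auto simp: bij_betw_def)
  have "digraph_iso G (with_proj (B1 n p q))"
  proof (rule digraph_isoI)
    show "digraph G" by (rule digraph_axioms)
    have vB: "pverts (B1 n p q) = {1..n}" using verts_B1[of p q n] pqn by simp
    show "bij_betw f (verts G) (pverts (B1 n p q))" unfolding vB by (rule bij)
    show "fst ` parcs (B1 n p q) \<subseteq> pverts (B1 n p q)"
      using digraph_B1[OF pqn p2 q1] wf_digraph.tail_in_verts[of "with_proj (B1 n p q)"]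
      by (auto simp: digraph_def fin_digraph_def)
    fix u assume "u \<in> verts G"
    then consider "u = v" | "u \<in> S" "u \<noteq> v" | "u \<in> T" | "u \<in> rest" "u = u1" | "u \<in> rest" "u \<noteq> u1"
      using S_T_rest(7) by blast
    then show "f ` (arcs_ends G `` {u}) = parcs (B1 n p q) `` {f u}"
    proof cases
      case 1
      have "f v = 1" by (simp add: f_def)
      then show ?thesis unfolding 1 extremal_at_v(1) using NB(1) fw imT by simp
    next
      case 2
      have "f u \<in> {1..p}" "f u \<noteq> f v"
        using 2 imS bij_betw_imp_inj_on[OF bS] exit(1) by (auto simp: inj_on_def)
      then have "1 < f u" "f u \<le> p" by (auto simp: f_def[of v])
      then show ?thesis unfolding extremal_at_S[OF 2] imT using NB(2) by simp
    next
      case 3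
      then have "f u \<in> {p+1..p+q}" using imT by blast
      then show ?thesis unfolding extremal_at_T[OF 3] imS using NB(3)[of "f u"] by simp
    next
      case 4
      have "f u = n" using frest[OF u1(1)] u1(2) 4 by simp
      moreover have "f u0 = p" using u0(4) by (simp add: f_def)
      ultimately show ?thesis using NB(5) u0(1) 4 by simp
    next
      case 5
      obtain u' where u': "arcs_ends G `` {u} = {u'}" "depth u = Suc (depth u')" "u' \<in> S \<union> rest"
        using extremal_at_rest[OF 5(1)] by metis
      have d: "depth u \<in> {1..k}" using 5(1) bij_betw_imp_surj_on[OF dbij] by blast
      have "depth u \<noteq> 1"
        using bij_betw_imp_inj_on[OF dbij] 5 u1 by (auto simp: inj_on_def)
      then have "depth u' \<noteq> 0" using u'(2) by simp
      then have "u' \<in> rest" using u'(3) depth_eq_0_iff[of u'] S_T_rest by auto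
      then have "f u' = Suc (f u)" using frest[OF 5(1)] frest[of u'] u'(2) d by (simp add: n_def)
      moreover have "p + q < f u" "f u < n"
        using frest[OF 5(1)] d \<open>depth u \<noteq> 1\<close> by (auto simp: n_def)
      ultimately show ?thesis using NB(4)[of "f u"] u'(1) by simp
    qed
  qed
  then show ?thesis by (simp add: n_def p_def q_def k_def)
qed

end

end

end

section \<open>The minimum of the \<open>A\<^sub>\<alpha>\<close> spectral radius\<close>

text \<open>The parts of the biclique are nonempty and completely joined, so they lie on opposite
  sides of the bipartition; the sides are named such that \<open>U\<close> lies in the
  first.\<close>

lemma bip_classE:
  assumes G: "G \<in> bip_class n p q" and pq: "1 \<le> p" "1 \<le> q"
  obtains X Y U V where "digraph G" "card (verts G) = n" "strongly_connected G"
    "verts G = X \<union> Y" "X \<inter> Y = {}"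
    "\<forall>u u'. u \<rightarrow>\<^bsub>G\<^esub> u' \<longrightarrow> u \<in> X \<and> u' \<in> Y \<or> u \<in> Y \<and> u' \<in> X"
    "U \<subseteq> X" "V \<subseteq> Y" "card U = p" "card V = q" "U \<times> V \<union> V \<times> U \<subseteq> arcs_ends G"
proof -
  from G obtain X Y H where dG: "digraph G" "card (verts G) = n" "strongly_connected G"
    and XY: "verts G = X \<union> Y" "X \<inter> Y = {}"
      "\<forall>u u'. u \<rightarrow>\<^bsub>G\<^esub> u' \<longrightarrow> u \<in> X \<and> u' \<in> Y \<or> u \<in> Y \<and> u' \<in> X"
    and H: "subgraph H G" "K\<^bsub>p,q\<^esub> H"
    unfolding bip_class_def bipartite_digraph_def by blast
  from H(2) obtain U V where UV: "card U = p" "card V = q" "arcs_ends H = U \<times> V \<union> V \<times> U"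
    unfolding complete_bipartite_digraph_def by blast
  have arcs: "U \<times> V \<union> V \<times> U \<subseteq> arcs_ends G" using arcs_ends_mono[OF H(1)] UV(3) by simp
  obtain a c where ac: "a \<in> U" "c \<in> V" using UV pq by (metis One_nat_def card.empty equals0I not_one_le_zero)
  have cross: "x \<in> X \<longleftrightarrow> x' \<in> Y" "x \<in> Y \<longleftrightarrow> x' \<in> X" if "x \<in> U" "x' \<in> V" for x x'
  proof -
    have "(x, x') \<in> arcs_ends G" using that arcs by blast
    then show "x \<in> X \<longleftrightarrow> x' \<in> Y" "x \<in> Y \<longleftrightarrow> x' \<in> X" using XY(2,3) by auto
  qed
  have "(a, c) \<in> arcs_ends G" using ac arcs by blast
  then consider "c \<in> Y" | "c \<in> X" using XY(3) by blast
  then show ?thesis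
  proof cases
    case 1
    then have "U \<subseteq> X" using cross ac(2) by blast
    moreover from this have "V \<subseteq> Y" using cross ac(1) by blast
    ultimately show ?thesis using that[OF dG XY _ _ UV(1,2) arcs] by blast
  next
    case 2
    then have sub: "U \<subseteq> Y" using cross ac(2) by blast
    then have "V \<subseteq> X" using cross ac(1) by blast
    moreover have "verts G = Y \<union> X" "Y \<inter> X = {}" using XY by auto
    moreover have "\<forall>u u'. u \<rightarrow>\<^bsub>G\<^esub> u' \<longrightarrow> u \<in> Y \<and> u' \<in> X \<or> u \<in> X \<and> u' \<in> Y" using XY(3) by blast
    ultimately show ?thesis using that[OF dG _ _ _ sub _ UV(1,2) arcs] by blast
  qed
qed

lemma (in wf_digraph) strongly_connected_exit:
  assumes "strongly_connected G" "A \<subset> verts G" "A \<noteq> {}"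
  obtains a c where "a \<in> A" "c \<notin> A" "a \<rightarrow>\<^bsub>G\<^esub> c"
proof -
  obtain u x where ux: "u \<in> A" "x \<in> verts G" "x \<notin> A" using assms(2,3) by blast
  then have "u \<rightarrow>\<^sup>*\<^bsub>G\<^esub> x" using assms(1,2) by (auto simp: strongly_connected_def)
  then have "x \<notin> A \<longrightarrow> (\<exists>a c. a \<in> A \<and> c \<notin> A \<and> a \<rightarrow>\<^bsub>G\<^esub> c)"
  proof (induction rule: reachable_induct)
    case base
    then show ?case using ux(1) by blast
  next
    case (step c d)
    then show ?case by blast
  qed
  then show ?thesis using ux(3) that by blast
qed

theorem theorem4p10:
  fixes \<alpha> :: real and n p q :: nat and G :: "('a,'b) pre_digraph"
  assumes "0 \<le> \<alpha>" and "\<alpha> < 1"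
    and "p \<ge> q" and "q \<ge> 2"
    and "p + q \<le> n - 1"
    and "\<not> [n = p + q] (mod 2)"
    and "G \<in> bip_class n p q"
  shows "lambda_alpha \<alpha> G \<ge> lambda_alpha \<alpha> (with_proj (B1 n p q)) \<and>
    (lambda_alpha \<alpha> G = lambda_alpha \<alpha> (with_proj (B1 n p q))
      \<longleftrightarrow> digraph_iso G (with_proj (B1 n p q)))"
proof -
  note \<alpha> = assms(1,2)
  define k where "k = n - p - q"
  have n: "n = p + q + k" and k: "0 < k" and pq: "p + q < n" "2 \<le> p" "1 \<le> q" "1 \<le> p"
    using assms(3-5) by (auto simp: k_def)
  \<comment> \<open>The congruence condition supplies the parity used to bound
    \<open>depth w\<close>.\<close>
  have oddk: "odd k"
  proof
    assume "even k"
    then have "[n = p + q] (mod 2)" unfolding n cong_def by (auto elim!: evenE)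
    then show False using assms(6) by simp
  qed
  have "1 \<le> real q" "real q \<le> real p" using pq assms(3) by auto
  from B1_parameters[OF \<alpha> this, of k] obtain \<rho> t b y :: real where
    \<rho>: "1 < \<rho>" and t: "t = (1 - \<alpha>) / (\<rho> - \<alpha>)" and b: "1 < b" and y: "t < y"
    and eqS: "\<rho> - \<alpha> * q = (1 - \<alpha>) * (q * y)"
    and eqv: "(\<rho> - \<alpha> * q - \<alpha>) * b = (1 - \<alpha>) * (q * y + t ^ k)"
    and eqT: "(\<rho> - \<alpha> * p) * y = (1 - \<alpha>) * (real p - 1 + b)"
    and swapped: "real q < real p \<longrightarrow> (\<exists>b' y' :: real. 1 \<le> b' \<and> t \<le> y' \<and>
      \<rho> - \<alpha> * p \<le> (1 - \<alpha>) * (p * y') \<and>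
      (\<rho> - \<alpha> * p - \<alpha>) * b' < (1 - \<alpha>) * (p * y' + t ^ k) \<and>
      (\<rho> - \<alpha> * q) * y' \<le> (1 - \<alpha>) * (real q - 1 + b'))"
    by blast
  have t0: "0 < t" using \<alpha> \<rho> by (simp add: t)
  have lamB: "lambda_alpha \<alpha> (with_proj (B1 n p q)) = \<rho>"
    using lambda_alpha_B1[OF \<alpha> pq(1-3) _ _ _ t eqS _ eqT] eqv b y t0 \<alpha> \<rho> unfolding k_def by simp
  obtain X Y U V where G: "digraph G" "card (verts G) = n" "strongly_connected G"
    and XY: "verts G = X \<union> Y" "X \<inter> Y = {}"
      "\<forall>u u'. u \<rightarrow>\<^bsub>G\<^esub> u' \<longrightarrow> u \<in> X \<and> u' \<in> Y \<or> u \<in> Y \<and> u' \<in> X"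
    and UV: "U \<subseteq> X" "V \<subseteq> Y" "card U = p" "card V = q" "U \<times> V \<union> V \<times> U \<subseteq> arcs_ends G"
    by (rule bip_classE[OF assms(7) pq(4,3)]) (rule that)
  interpret digraph G by (rule G(1))
  have disj: "U \<inter> V = {}" using UV(1,2) XY(2) by blast
  have sub: "U \<union> V \<subseteq> verts G" unfolding XY(1) using UV(1,2) by blast
  then have fin: "finite U" "finite V" using finite_subset[OF sub finite_verts] by auto
  have cardr: "card (verts G - U - V) = k"
  proof -
    have "verts G - U - V = verts G - (U \<union> V)" by auto
    then show ?thesis
      using card_Diff_subset[OF _ sub] fin disj UV G(2) by (simp add: card_Un_disjoint n)
  qed
  have "verts G - V - U = verts G - U - V" by blast
  then have cardr': "card (verts G - V - U) = k" using cardr by simp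
  have "verts G - U - V \<noteq> {}" using cardr k card.empty by (metis less_irrefl)
  then have "U \<union> V \<noteq> verts G" by blast
  moreover have "U \<noteq> {}" using UV(3) pq by auto
  ultimately obtain v w where vw: "v \<in> U \<union> V" "w \<notin> U \<union> V" "v \<rightarrow>\<^bsub>G\<^esub> w"
    using strongly_connected_exit[OF G(3), of "U \<union> V"] sub by blast
  \<comment> \<open>A start in a part of size \<open>p\<close>: the parameters of \<open>B1\<close>
    satisfy all three bounds with equality.\<close>
  have main: "\<rho> \<le> lambda_alpha \<alpha> G \<and> (lambda_alpha \<alpha> G = \<rho> \<longrightarrow> digraph_iso G (with_proj (B1 n p q)))"
    if ext: "extended_biclique G S T X' Y' v w" and ST: "card S = p" "card T = q"
      and cr: "card (verts G - S - T) = k" for S T X' Y'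
  proof -
    interpret E: extended_biclique G S T X' Y' v w by (rule ext)
    have r: "card E.rest = k" using cr by (simp add: E.rest_def)
    note params = \<alpha> \<rho> t less_imp_le[OF b] less_imp_le[OF y]
    have bounds: "\<rho> - \<alpha> * card T \<le> (1 - \<alpha>) * (card T * y)"
      "(\<rho> - \<alpha> * card T - \<alpha>) * b \<le> (1 - \<alpha>) * (card T * y + t ^ card E.rest)"
      "(\<rho> - \<alpha> * card S) * y \<le> (1 - \<alpha>) * (real (card S) - 1 + b)"
      unfolding ST r using eqS eqv eqT by simp_all
    show ?thesis
      using E.lambda_alpha_ge[OF params bounds] E.extremal_iso[OF params bounds _ b y] pq
      unfolding ST r n by simp
  qed
  have "\<rho> \<le> lambda_alpha \<alpha> G \<and> (lambda_alpha \<alpha> G = \<rho> \<longrightarrow> digraph_iso G (with_proj (B1 n p q)))"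
  proof (cases "v \<in> U")
    case True
    have "extended_biclique G U V X Y v w"
      by unfold_locales (use G XY UV vw True oddk cardr in auto)
    then show ?thesis using main UV(3,4) cardr by blast
  next
    case False
    have UV': "V \<times> U \<union> U \<times> V \<subseteq> arcs_ends G" using UV(5) by blast
    have ext: "extended_biclique G V U Y X v w"
      by unfold_locales (use G XY UV vw False oddk cardr' UV' in auto)
    \<comment> \<open>For equal sizes \<open>V\<close> can take the role of the part of size
      \<open>p\<close>; otherwise \<open>b'\<close> and \<open>y'\<close> give a strict inequality,
      and the equality claim is vacuous.\<close>
    show ?thesis
    proof (cases "p = q")
      case True
      then show ?thesis using main[OF ext] UV(3,4) cardr' by simp
    next
      case False
      then have "real q < real p" using assms(3) by simp
      with swapped obtain b' y' :: real where b': "1 \<le> b'" "t \<le> y'"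
        "\<rho> - \<alpha> * p \<le> (1 - \<alpha>) * (p * y')"
        "(\<rho> - \<alpha> * p - \<alpha>) * b' < (1 - \<alpha>) * (p * y' + t ^ k)"
        "(\<rho> - \<alpha> * q) * y' \<le> (1 - \<alpha>) * (real q - 1 + b')" by blast
      interpret E: extended_biclique G V U Y X v w by (rule ext)
      have r: "card E.rest = k" using cardr' by (simp add: E.rest_def)
      have "\<rho> < lambda_alpha \<alpha> G"
        by (rule E.lambda_alpha_gt[OF \<alpha> \<rho> t b'(1,2)])
          (use b' UV(3,4) r in simp_all)
      then show ?thesis by simp
    qed
  qed
  \<comment> \<open>The converse of the equality claim is the invariance of
    \<open>lambda_alpha\<close> under isomorphism.\<close>
  then show ?thesis
    using lambda_alpha_iso[OF G(1) digraph_B1[OF pq(1-3)]] lamB by auto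
qed

end
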